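(* Let $\alpha\in(0,2]$ and let $S=S^{\mathrm{sta}}_{\alpha}$ be the standardized kernel scoring rule on $\mathbb{R}$, $$S^{\mathrm{sta}}_{\alpha}(\mathbb{P},y) = -\frac12\log\left(\mathsf{E}_{\mathbb{P},\mathbb{P}}[|X-Y|^{\alpha}]\right) - \frac{\mathsf{E}_{\mathbb{P}}[|X-y|^{\alpha}]}{\mathsf{E}_{\mathbb{P},\mathbb{P}}[|X-Y|^{\alpha}]} + 1.$$ Let $\mathcal{Q}$ be a class of probability measures $\mathbb{Q}_\theta$, $\theta=(\mu,\sigma)\in\mathbb{R}\times(0,\infty)$, which are location-scale transformations of base measures $\mathbb{Q}$ satisfying Assumption A (stated in the context) for this $\alpha$. Then $S^{\mathrm{sta}}_{\alpha}$ has scale function $$s(\mathbb{Q}_\theta) = \frac{1}{\sigma^2}\,\mathsf{E}_{\mathbb{Q},\mathbb{Q}}[H^{\alpha}_{\mathbb{Q}}(X,Y)]$$ on $\mathcal{Q}$, where $H^{\alpha}_{\mathbb{Q}}(X,Y)$ is a $2\times2$ matrix (a function of $X,Y$, depending on $\mathbb{Q}$ and $\alpha$) independent of $\theta$.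
   Context: $\mathsf{E}_{\mathbb{P}}$ is expectation for $X\sim\mathbb{P}$; $\mathsf{E}_{\mathbb{P},\mathbb{Q}}$ is expectation for independent $X\sim\mathbb{P}$, $Y\sim\mathbb{Q}$. For a scoring rule $S$, $S(\mathbb{P},\mathbb{Q})$ is the expected value of $S(\mathbb{P},Y)$ when $Y\sim\mathbb{Q}$. Location-scale transformations: for a probability measure $\mathbb{Q}$ on $\mathbb{R}$ and $\theta=(\mu,\sigma)\in\mathbb{R}\times(0,\infty)$, $\mathbb{Q}_\theta$ is the law of $\mu+\sigma Z$ with $Z\sim\mathbb{Q}$. For a set $\mathcal{Q}_0$ of base measures, $\mathcal{Q}=\{\mathbb{Q}_\theta:\mathbb{Q}\in\mathcal{Q}_0,\theta\in\mathbb{R}\times(0,\infty)\}$, and it is assumed that $|S(\mathbb{P},\mathbb{P}')|<\infty$ for all $\mathbb{P},\mathbb{P}'\in\mathcal{Q}$. Scale function: $S$ has scale function $s$ on $\mathcal{Q}$ if, for every $\mathbb{Q}_\theta\in\mathcal{Q}$, $s(\mathbb{Q}_\theta)$ is the symmetric $2\times 2$ matrix with $S(\mathbb{Q}_\theta,\mathbb{Q}_\theta)-S(\mathbb{Q}_{\theta+d\theta},\mathbb{Q}_\theta)=d\theta^T s(\mathbb{Q}_\theta)\,d\theta+o(\|d\theta\|^2)$ as $d\theta\to0$. Assumption A (with parameter $\alpha\ge0$): the probability measure $\mathbb{Q}$ on $(\mathbb{R},\mathcal{B}(\mathbb{R}))$ has density $\exp(\Psi)$ with respect to Lebesgue measure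 for some twice differentiable function $\Psi$ such that $\mathsf{E}_{\mathbb{Q}}[\Psi'(X)]$, $\mathsf{E}_{\mathbb{Q}}[\Psi''(X)]$, $\mathsf{E}_{\mathbb{Q}}[(\Psi'(X))^2]$ are finite, and $\mathsf{E}_{\mathbb{Q}}[|X|^{\alpha}]$, $\mathsf{E}_{\mathbb{Q}}[|X|^{\alpha+1}\Psi'(X)]$, $\mathsf{E}_{\mathbb{Q}}[|X|^{\alpha+3}\Psi''(X)]$, $\mathsf{E}_{\mathbb{Q}}[|X|^{\alpha+3}(\Psi'(X))^2]$ are finite. *)

theory Defs
  imports "HOL-Probability.Probability" "HOL-Library.Landau_Symbols"
begin

text \<open>
  A parameter \<open>\<theta> = (\<mu>, \<sigma>)\<close> is a vector of type \<^typ>\<open>real^2\<close> whose first component is the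
  location and whose second component is the (positive) scale.
\<close>

definition loc_scale_params :: "(real^2) set" where
  "loc_scale_params = {\<theta>. 0 < \<theta> $ 2}"

definition loc_scale :: "real measure \<Rightarrow> real^2 \<Rightarrow> real measure" where
  "loc_scale Q \<theta> = distr Q borel (\<lambda>z. \<theta> $ 1 + \<theta> $ 2 * z)"

definition loc_scale_class :: "real measure set \<Rightarrow> real measure set" where
  "loc_scale_class Q0 = {loc_scale Q \<theta> | Q \<theta>. Q \<in> Q0 \<and> \<theta> \<in> loc_scale_params}"

type_synonym scoring_rule = "real measure \<Rightarrow> real \<Rightarrow> real"

definition expected_score :: "scoring_rule \<Rightarrow> real measure \<Rightarrow> real measure \<Rightarrow> real" where
  "expected_score S P Q = (\<integral>y. S P y \<partial>Q)"

definition finite_scores_on :: "real measure set \<Rightarrow> scoring_rule \<Rightarrow> bool" where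
  "finite_scores_on QQ S \<longleftrightarrow> (\<forall>P\<in>QQ. \<forall>P'\<in>QQ. integrable P' (S P))"

text \<open>
  The increment \<open>d\<theta>\<close> acts on the parametrisation of the class, and one measure may be
  \<open>loc_scale Q \<theta>\<close> for several pairs \<open>(Q, \<theta>)\<close> (when one base measure is a location-scale
  transformation of another). The matrix written \<open>s(Q\<^sub>\<theta>)\<close> depends on the pair, so \<open>s\<close> takes
  \<open>Q\<close> and \<open>\<theta>\<close> as arguments.
\<close>

definition has_scale_function ::
  "scoring_rule \<Rightarrow> real measure set \<Rightarrow> (real measure \<Rightarrow> real^2 \<Rightarrow> real^2^2) \<Rightarrow> bool" where
  "has_scale_function S Q0 s \<longleftrightarrow>
     (\<forall>Q\<in>Q0. \<forall>\<theta>\<in>loc_scale_params.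
        transpose (s Q \<theta>) = s Q \<theta> \<and>
        (\<lambda>d. expected_score S (loc_scale Q \<theta>) (loc_scale Q \<theta>)
              - expected_score S (loc_scale Q (\<theta> + d)) (loc_scale Q \<theta>)
              - d \<bullet> (s Q \<theta> *v d))
          \<in> o[at 0](\<lambda>d. norm d ^ 2))"

text \<open>
  \<open>0 powr 0 = 0\<close> in HOL, so for \<open>\<alpha> = 0\<close> the integrand \<open>\<bar>x\<bar> powr \<alpha>\<close> differs from the constant
  \<open>1\<close> at the null set \<open>{0}\<close>; this does not affect integrability.
\<close>

definition assumption_A :: "real \<Rightarrow> real measure \<Rightarrow> bool" where
  "assumption_A \<alpha> Q \<longleftrightarrow>
     prob_space Q \<and>
     (\<exists>\<Psi> \<Psi>' \<Psi>'' :: real \<Rightarrow> real.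
        (\<forall>x. (\<Psi> has_real_derivative \<Psi>' x) (at x)) \<and>
        (\<forall>x. (\<Psi>' has_real_derivative \<Psi>'' x) (at x)) \<and>
        Q = density lborel (\<lambda>x. ennreal (exp (\<Psi> x))) \<and>
        integrable Q \<Psi>' \<and>
        integrable Q \<Psi>'' \<and>
        integrable Q (\<lambda>x. (\<Psi>' x)\<^sup>2) \<and>
        integrable Q (\<lambda>x. \<bar>x\<bar> powr \<alpha>) \<and>
        integrable Q (\<lambda>x. \<bar>x\<bar> powr (\<alpha> + 1) * \<Psi>' x) \<and>
        integrable Q (\<lambda>x. \<bar>x\<bar> powr (\<alpha> + 3) * \<Psi>'' x) \<and>
        integrable Q (\<lambda>x. \<bar>x\<bar> powr (\<alpha> + 3) * (\<Psi>' x)\<^sup>2))"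

definition kernel_moment :: "real \<Rightarrow> real measure \<Rightarrow> real" where
  "kernel_moment \<alpha> P = (\<integral>(x, y). \<bar>x - y\<bar> powr \<alpha> \<partial>(P \<Otimes>\<^sub>M P))"

definition S_sta :: "real \<Rightarrow> scoring_rule" where
  "S_sta \<alpha> P y =
     - (1 / 2) * ln (kernel_moment \<alpha> P)
     - (\<integral>x. \<bar>x - y\<bar> powr \<alpha> \<partial>P) / kernel_moment \<alpha> P + 1"

end

theory Submission
  imports Defs
begin

text \<open>
  Let \<open>f = exp \<Psi>\<close> be the density of \<open>Q\<close>, let \<open>X\<close>, \<open>Y\<close> be independent with law \<open>Q\<close>, and put
  \<open>K = E \<bar>X - Y\<bar> powr \<alpha>\<close>. The kernel and its moments are homogeneous, so an increment \<open>d\<close> of the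
  parameter \<open>\<theta>\<close> enters the score difference only through \<open>u = d $ 1 / \<sigma>\<close> and
  \<open>s = 1 + d $ 2 / \<sigma>\<close>, where \<open>\<sigma> = \<theta> $ 2\<close>:
  the difference equals \<open>\<alpha> / 2 * ln s + s powr (- \<alpha>) * m u s / K - 1\<close> with the cross moment
  \<open>m u s = E \<bar>u + s * X - Y\<bar> powr \<alpha>\<close> (lemma \<open>score_increment\<close>). This explains the factor \<open>1 / \<sigma>\<^sup>2\<close>, and
  it remains to expand a single function of \<open>(u, s)\<close> to second order at \<open>(0, 1)\<close>.

  The kernel itself is not smooth enough for that: for small \<open>\<alpha>\<close> it has no derivative at the origin.
  The smoothness comes from the density instead. Write \<open>m u s = \<integral> \<phi> (u + s x) f x dx\<close> with
  \<open>\<phi> z = E \<bar>z - Y\<bar> powr \<alpha>\<close>, of which only continuity and growth of order \<open>\<alpha>\<close> are used. Substituting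
  \<open>z = u + s x\<close> moves the parameters from \<open>\<phi>\<close> into \<open>f\<close>, where one can differentiate; moving them back
  gives an integral of the same form, in which \<open>f\<close> has become \<open>((a + b x) f)'\<close> for the direction
  \<open>(a, b)\<close> of differentiation (lemma \<open>affine_mean_has_derivative_ray\<close>). Doing this twice leaves
  integrals of \<open>\<phi> (u + s x)\<close> against polynomials in \<open>x\<close> times \<open>f\<close>, \<open>f'\<close>, \<open>f''\<close>; the moment conditions on
  \<open>\<Psi>'\<close> and \<open>\<Psi>''\<close> say that these converge, and by dominated convergence they are continuous in \<open>(u, s)\<close>.
  Taylor's theorem along each ray then gives a remainder that is uniformly small
  (lemma \<open>second_order_expansion_along_rays\<close>).

  The first-order terms vanish because exchanging \<open>X\<close> and \<open>Y\<close> gives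
  \<open>m u s = s powr \<alpha> * m (- u / s) (1 / s)\<close> (lemma \<open>m_swap\<close>). The same identity evaluates the integrals
  that contain \<open>f'\<close>, so only \<open>f'' = (\<Psi>'' + \<Psi>'\<^sup>2) f\<close> survives in the second-order term. With
  \<open>q = \<Psi>'' + \<Psi>'\<^sup>2\<close> this results in
  \<open>H (X, Y) = \<bar>X - Y\<bar> powr \<alpha> * q X / (2 K) * (1, X)\<^sup>T (1, X) - diag (0, 1 + 3 \<alpha> / 4)\<close>.
\<close>

section \<open>Weighted integrability\<close>

text \<open>
  The weight has the growth of the kernel, so that a weighted integrable function can be integrated
  against the kernel composed with any affine map.
\<close>
definition weighted_integrable :: "real \<Rightarrow> (real \<Rightarrow> real) \<Rightarrow> bool" where
  "weighted_integrable \<alpha> g \<longleftrightarrow> integrable lborel (\<lambda>x. (1 + \<bar>x\<bar> powr \<alpha>) * g x)"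

lemma weighted_integrable_add:
  assumes "weighted_integrable \<alpha> g" "weighted_integrable \<alpha> h"
  shows "weighted_integrable \<alpha> (\<lambda>x. g x + h x)"
  using Bochner_Integration.integrable_add[OF assms[unfolded weighted_integrable_def]]
  by (simp add: weighted_integrable_def distrib_left)

lemma weighted_integrable_mult_left:
  assumes "weighted_integrable \<alpha> g"
  shows "weighted_integrable \<alpha> (\<lambda>x. c * g x)"
  using integrable_mult_right[OF assms[unfolded weighted_integrable_def], of c]
  by (simp add: weighted_integrable_def mult.left_commute)

lemma weighted_integrable_abs:
  assumes "weighted_integrable \<alpha> g"
  shows "weighted_integrable \<alpha> (\<lambda>x. \<bar>g x\<bar>)"
  using integrable_abs[OF assms[unfolded weighted_integrable_def]]
  by (simp add: weighted_integrable_def abs_mult)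

lemma weighted_integrable_measurable:
  assumes "weighted_integrable \<alpha> g"
  shows "g \<in> borel_measurable borel"
proof -
  have "(\<lambda>x. (1 + \<bar>x\<bar> powr \<alpha>) * g x) \<in> borel_measurable borel"
    using assms borel_measurable_integrable unfolding weighted_integrable_def by fastforce
  then have "(\<lambda>x. (1 + \<bar>x\<bar> powr \<alpha>) * g x / (1 + \<bar>x\<bar> powr \<alpha>)) \<in> borel_measurable borel"
    by measurable
  moreover have "1 + \<bar>x\<bar> powr \<alpha> \<noteq> 0" for x :: real
    by (metis add_nonneg_pos add.commute less_numeral_extra(3) powr_ge_zero zero_less_one)
  ultimately show ?thesis by simp
qed

lemma powr_abs_affine_le:
  fixes u s x \<alpha> :: real
  assumes "0 \<le> \<alpha>"
  shows "\<bar>u + s * x\<bar> powr \<alpha> \<le> (\<bar>u\<bar> + \<bar>s\<bar>) powr \<alpha> * (1 + \<bar>x\<bar> powr \<alpha>)"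
proof -
  have "\<bar>u + s * x\<bar> \<le> \<bar>u\<bar> * 1 + \<bar>s\<bar> * \<bar>x\<bar>"
    by (metis abs_mult abs_triangle_ineq mult.right_neutral)
  also have "\<dots> \<le> (\<bar>u\<bar> + \<bar>s\<bar>) * max 1 \<bar>x\<bar>"
    unfolding distrib_right by (intro add_mono mult_left_mono) auto
  finally have "\<bar>u + s * x\<bar> powr \<alpha> \<le> ((\<bar>u\<bar> + \<bar>s\<bar>) * max 1 \<bar>x\<bar>) powr \<alpha>"
    by (intro powr_mono2 assms) auto
  also have "\<dots> = (\<bar>u\<bar> + \<bar>s\<bar>) powr \<alpha> * max 1 \<bar>x\<bar> powr \<alpha>"
    by (rule powr_mult)
  also have "max 1 \<bar>x\<bar> powr \<alpha> \<le> 1 + \<bar>x\<bar> powr \<alpha>"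
    by (cases "\<bar>x\<bar> \<le> 1") (auto simp: max_def)
  finally show ?thesis
    by (simp add: mult_left_mono)
qed

section \<open>Averages of a kernel under an affine group\<close>

text \<open>
  When \<open>g\<close> is the density of \<open>X\<close>, this is the expectation of \<open>\<phi> (u + s X)\<close>; derivatives with respect to
  \<open>u\<close> and \<open>s\<close> are again of this form, with \<open>g\<close> replaced by derivatives of the density.
\<close>
definition affine_mean :: "(real \<Rightarrow> real) \<Rightarrow> (real \<Rightarrow> real) \<Rightarrow> real \<Rightarrow> real \<Rightarrow> real" where
  "affine_mean \<phi> g u s = (\<integral>x. \<phi> (u + s * x) * g x \<partial>lborel)"

locale growth_kernel =
  fixes \<phi> :: "real \<Rightarrow> real" and \<alpha> C :: real
  assumes cont: "continuous_on UNIV \<phi>"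
    and bound: "\<bar>\<phi> z\<bar> \<le> C * (1 + \<bar>z\<bar> powr \<alpha>)"
    and exponent_nonneg: "0 \<le> \<alpha>"
begin

lemma measurable_kernel [measurable]: "\<phi> \<in> borel_measurable borel"
  using borel_measurable_continuous_onI[OF cont] .

lemma C_nonneg: "0 \<le> C"
proof -
  have "0 \<le> C * (1 + \<bar>1\<bar> powr \<alpha>)" using bound[of 1] abs_ge_zero order_trans by blast
  then show ?thesis by simp
qed

lemma bound_affine:
  assumes "\<bar>u\<bar> + \<bar>s\<bar> \<le> B"
  shows "\<bar>\<phi> (u + s * x)\<bar> \<le> C * (1 + B powr \<alpha>) * (1 + \<bar>x\<bar> powr \<alpha>)"
proof -
  have "\<bar>u + s * x\<bar> powr \<alpha> \<le> (\<bar>u\<bar> + \<bar>s\<bar>) powr \<alpha> * (1 + \<bar>x\<bar> powr \<alpha>)"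
    by (rule powr_abs_affine_le[OF exponent_nonneg])
  also have "\<dots> \<le> B powr \<alpha> * (1 + \<bar>x\<bar> powr \<alpha>)"
    using assms exponent_nonneg by (intro mult_right_mono powr_mono2) auto
  finally have "1 + \<bar>u + s * x\<bar> powr \<alpha> \<le> 1 * 1 + B powr \<alpha> * (1 + \<bar>x\<bar> powr \<alpha>)" by simp
  also have "\<dots> \<le> (1 + B powr \<alpha>) * (1 + \<bar>x\<bar> powr \<alpha>)"
    by (simp add: distrib_right)
  finally have "C * (1 + \<bar>u + s * x\<bar> powr \<alpha>) \<le> C * ((1 + B powr \<alpha>) * (1 + \<bar>x\<bar> powr \<alpha>))"
    using C_nonneg by (rule mult_left_mono)
  with bound[of "u + s * x"] show ?thesis by (simp add: mult.assoc)
qed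

lemma integrable_affine:
  assumes g: "weighted_integrable \<alpha> g"
  shows "integrable lborel (\<lambda>x. \<phi> (u + s * x) * g x)"
proof (rule Bochner_Integration.integrable_bound)
  note [measurable] = weighted_integrable_measurable[OF g]
  let ?c = "C * (1 + (\<bar>u\<bar> + \<bar>s\<bar>) powr \<alpha>)"
  show "integrable lborel (\<lambda>x. ?c * ((1 + \<bar>x\<bar> powr \<alpha>) * g x))"
    using g unfolding weighted_integrable_def by (rule integrable_mult_right)
  show "(\<lambda>x. \<phi> (u + s * x) * g x) \<in> borel_measurable lborel" by measurable
  have "\<bar>\<phi> (u + s * x)\<bar> * \<bar>g x\<bar> \<le> ?c * (1 + \<bar>x\<bar> powr \<alpha>) * \<bar>g x\<bar>" for x
    by (intro mult_right_mono bound_affine) auto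
  then show "AE x in lborel. norm (\<phi> (u + s * x) * g x) \<le> norm (?c * ((1 + \<bar>x\<bar> powr \<alpha>) * g x))"
    using C_nonneg by (auto simp: abs_mult mult.assoc)
qed

text \<open>
  Along a convergent sequence of parameters \<open>\<bar>u\<bar> + \<bar>s\<bar>\<close> stays bounded, so \<open>bound_affine\<close> provides one
  integrable majorant for all the integrands.
\<close>
lemma continuous_affine_mean:
  assumes g: "weighted_integrable \<alpha> g"
  shows "continuous_on UNIV (\<lambda>p. affine_mean \<phi> g (fst p) (snd p))"
  unfolding continuous_on_sequentially comp_def
proof (intro allI ballI impI)
  fix p :: "nat \<Rightarrow> real \<times> real" and q
  assume "(\<forall>n. p n \<in> UNIV) \<and> p \<longlonglongrightarrow> q"
  then have p: "p \<longlonglongrightarrow> q" by simp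
  note [measurable] = weighted_integrable_measurable[OF g]
  have lim1: "(\<lambda>n. fst (p n)) \<longlonglongrightarrow> fst q" and lim2: "(\<lambda>n. snd (p n)) \<longlonglongrightarrow> snd q"
    using p tendsto_fst tendsto_snd by blast+
  then obtain B1 B2 where "\<And>n. \<bar>fst (p n)\<bar> \<le> B1" "\<And>n. \<bar>snd (p n)\<bar> \<le> B2"
    using Bseq_def convergentI convergent_imp_Bseq
    by (metis (no_types, lifting) real_norm_def)
  then have B: "\<bar>fst (p n)\<bar> + \<bar>snd (p n)\<bar> \<le> B1 + B2" for n
    by (simp add: add_mono)
  let ?c = "C * (1 + (B1 + B2) powr \<alpha>)"
  show "(\<lambda>n. affine_mean \<phi> g (fst (p n)) (snd (p n))) \<longlonglongrightarrow> affine_mean \<phi> g (fst q) (snd q)"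
    unfolding affine_mean_def
  proof (rule integral_dominated_convergence)
    show "integrable lborel (\<lambda>x. ?c * ((1 + \<bar>x\<bar> powr \<alpha>) * \<bar>g x\<bar>))"
      using weighted_integrable_abs[OF g] unfolding weighted_integrable_def by (rule integrable_mult_right)
    show "AE x in lborel. norm (\<phi> (fst (p n) + snd (p n) * x) * g x) \<le> ?c * ((1 + \<bar>x\<bar> powr \<alpha>) * \<bar>g x\<bar>)" for n
      using mult_right_mono[OF bound_affine[OF B] abs_ge_zero]
      by (auto simp: abs_mult mult.assoc)
    have "(\<lambda>n. \<phi> (fst (p n) + snd (p n) * x)) \<longlonglongrightarrow> \<phi> (fst q + snd q * x)" for x
      by (rule isCont_tendsto_compose[where g=\<phi>])
        (use cont in \<open>auto simp: continuous_on_eq_continuous_at intro!: tendsto_intros lim1 lim2\<close>)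
    then show "AE x in lborel. (\<lambda>n. \<phi> (fst (p n) + snd (p n) * x) * g x) \<longlonglongrightarrow> \<phi> (fst q + snd q * x) * g x"
      by (intro AE_I2 tendsto_intros)
  qed measurable
qed

lemma affine_mean_add:
  assumes "weighted_integrable \<alpha> g" "weighted_integrable \<alpha> h"
  shows "affine_mean \<phi> (\<lambda>x. g x + h x) u s = affine_mean \<phi> g u s + affine_mean \<phi> h u s"
  using integrable_affine[OF assms(1)] integrable_affine[OF assms(2)]
  by (simp add: affine_mean_def distrib_left)

lemma affine_mean_cmult:
  "affine_mean \<phi> (\<lambda>x. c * g x) u s = c * affine_mean \<phi> g u s"
  by (simp add: affine_mean_def mult.left_commute)

text \<open>
  As \<open>\<phi>\<close> need not be differentiable, the parameters are first moved into \<open>g\<close> by the substitution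
  \<open>z = u + t a + (s + t b) x\<close>. For fixed \<open>z\<close> the fundamental theorem of calculus applies in \<open>t\<close>, and
  Fubini's theorem exchanges the integrals over \<open>t\<close> and \<open>z\<close>. An integrated identity is used because
  the derivative of \<open>g\<close> is only integrable: no majorant uniform in \<open>t\<close> is available that would allow
  differentiation under the integral sign.
\<close>
lemma affine_mean_FTC:
  fixes u a s b l h :: real and g g' :: "real \<Rightarrow> real"
  assumes der: "\<And>x. (g has_real_derivative g' x) (at x)"
    and g: "weighted_integrable \<alpha> g"
    and Lg: "weighted_integrable \<alpha> (\<lambda>x. b * g x + (a + b * x) * g' x)"
    and lh: "l \<le> h" and pos: "\<And>t. t \<in> {l..h} \<Longrightarrow> 0 < s + t * b"
  defines "L \<equiv> \<lambda>x. b * g x + (a + b * x) * g' x"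
  shows "affine_mean \<phi> g (u + h * a) (s + h * b) - affine_mean \<phi> g (u + l * a) (s + l * b)
       = integral {l..h} (\<lambda>t. - (1 / (s + t * b)) * affine_mean \<phi> L (u + t * a) (s + t * b))"
proof -
  have L: "weighted_integrable \<alpha> L" using Lg unfolding L_def .
  note [measurable] = weighted_integrable_measurable[OF L] weighted_integrable_measurable[OF g]
  define X where "X t z = (z - (u + t * a)) / (s + t * b)" for t z
  define p where "p t z = g (X t z) / (s + t * b)" for t z
  define p' where "p' t z = - L (X t z) / (s + t * b)\<^sup>2" for t z
  define J where "J t = - (1 / (s + t * b)) * affine_mean \<phi> L (u + t * a) (s + t * b)" for t
  define F where "F = (\<lambda>(t, z). indicator {l..h} t * (\<phi> z * p' t z))"
  \<comment> \<open>\<open>X t z\<close> solves \<open>z = u + t a + (s + t b) x\<close> for \<open>x\<close>, so its derivative in \<open>t\<close> is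
    \<open>- (a + b * X t z) / (s + t b)\<close>; together with the Jacobian factor this produces \<open>L\<close>.\<close>
  have der_p: "((\<lambda>t. p t z) has_real_derivative p' t z) (at t)" if "t \<in> {l..h}" for t z
  proof -
    have c: "s + t * b \<noteq> 0" using pos[OF that] by simp
    have "((\<lambda>t. X t z) has_real_derivative
        (- a * (s + t * b) - (z - (u + t * a)) * b) / ((s + t * b) * (s + t * b))) (at t)"
      unfolding X_def using c by (auto intro!: derivative_eq_intros)
    also have "(- a * (s + t * b) - (z - (u + t * a)) * b) / ((s + t * b) * (s + t * b))
        = - (a + b * X t z) / (s + t * b)"
      using c unfolding X_def by (simp add: divide_simps)
    finally have dX: "((\<lambda>t. X t z) has_real_derivative - (a + b * X t z) / (s + t * b)) (at t)" .
    have "((\<lambda>t. p t z) has_real_derivative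
       (g' (X t z) * (- (a + b * X t z) / (s + t * b)) * (s + t * b) - g (X t z) * b) / ((s + t * b) * (s + t * b))) (at t)"
      unfolding p_def using c
      by (auto intro!: derivative_eq_intros DERIV_chain2[OF der dX])
    also have "(g' (X t z) * (- (a + b * X t z) / (s + t * b)) * (s + t * b) - g (X t z) * b) / ((s + t * b) * (s + t * b)) = p' t z"
      using c unfolding p'_def L_def by (simp add: power2_eq_square divide_simps) (simp add: algebra_simps)
    finally show ?thesis .
  qed
  have change: "(\<integral>z. G z (X t z) \<partial>lborel) = (s + t * b) * (\<integral>x. G (u + t * a + (s + t * b) * x) x \<partial>lborel)"
    and change_int: "integrable lborel (\<lambda>z. G z (X t z)) \<longleftrightarrow> integrable lborel (\<lambda>x. G (u + t * a + (s + t * b) * x) x)"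
    if t: "t \<in> {l..h}" for t and G :: "real \<Rightarrow> real \<Rightarrow> real"
  proof -
    have c: "s + t * b \<noteq> 0" "\<bar>s + t * b\<bar> = s + t * b" using pos[OF t] by auto
    have *: "X t (u + t * a + (s + t * b) * x) = x" for x
      using c by (simp add: X_def)
    show "(\<integral>z. G z (X t z) \<partial>lborel) = (s + t * b) * (\<integral>x. G (u + t * a + (s + t * b) * x) x \<partial>lborel)"
      using lborel_integral_real_affine[OF c(1), of "\<lambda>z. G z (X t z)" "u + t * a"] c(2) * by simp
    show "integrable lborel (\<lambda>z. G z (X t z)) \<longleftrightarrow> integrable lborel (\<lambda>x. G (u + t * a + (s + t * b) * x) x)"
      using lborel_integrable_real_affine_iff[OF c(1), of "\<lambda>z. G z (X t z)" "u + t * a"] * by simp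
  qed
  have int_p: "(\<integral>z. \<phi> z * p t z \<partial>lborel) = affine_mean \<phi> g (u + t * a) (s + t * b)"
    and integrable_p: "integrable lborel (\<lambda>z. \<phi> z * p t z)"
    and int_p': "(\<integral>z. \<phi> z * p' t z \<partial>lborel) = J t"
    and integrable_p': "integrable lborel (\<lambda>z. \<phi> z * p' t z)"
    and int_abs_p': "(\<integral>z. \<bar>\<phi> z * p' t z\<bar> \<partial>lborel)
        = 1 / (s + t * b) * affine_mean (\<lambda>z. \<bar>\<phi> z\<bar>) (\<lambda>x. \<bar>L x\<bar>) (u + t * a) (s + t * b)"
    if t: "t \<in> {l..h}" for t
  proof -
    have c: "s + t * b > 0" using pos[OF t] .
    show "(\<integral>z. \<phi> z * p t z \<partial>lborel) = affine_mean \<phi> g (u + t * a) (s + t * b)"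
      using c unfolding p_def affine_mean_def change[OF t, of "\<lambda>z x. \<phi> z * (g x / (s + t * b))"] by simp
    show "integrable lborel (\<lambda>z. \<phi> z * p t z)"
      unfolding p_def change_int[OF t, of "\<lambda>z x. \<phi> z * (g x / (s + t * b))"]
      using integrable_affine[OF g] by simp
    show "(\<integral>z. \<phi> z * p' t z \<partial>lborel) = J t"
      using c unfolding p'_def J_def affine_mean_def change[OF t, of "\<lambda>z x. \<phi> z * (- L x / (s + t * b)\<^sup>2)"]
      by (simp add: power2_eq_square)
    show "integrable lborel (\<lambda>z. \<phi> z * p' t z)"
      unfolding p'_def change_int[OF t, of "\<lambda>z x. \<phi> z * (- L x / (s + t * b)\<^sup>2)"]
      using integrable_affine[OF L] by simp
    show "(\<integral>z. \<bar>\<phi> z * p' t z\<bar> \<partial>lborel)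
        = 1 / (s + t * b) * affine_mean (\<lambda>z. \<bar>\<phi> z\<bar>) (\<lambda>x. \<bar>L x\<bar>) (u + t * a) (s + t * b)"
      using c unfolding p'_def affine_mean_def change[OF t, of "\<lambda>z x. \<bar>\<phi> z * (- L x / (s + t * b)\<^sup>2)\<bar>"]
      by (simp add: abs_mult power2_eq_square)
  qed
  have cont_ray: "continuous_on {l..h} (\<lambda>t. c / (s + t * b) * affine_mean \<psi> G (u + t * a) (s + t * b))"
    if "growth_kernel \<psi> \<alpha> C" "weighted_integrable \<alpha> G" for \<psi> G and c :: real
  proof -
    have "continuous_on {l..h} (\<lambda>t. affine_mean \<psi> G (fst (u + t * a, s + t * b)) (snd (u + t * a, s + t * b)))"
      by (rule continuous_on_compose2[OF growth_kernel.continuous_affine_mean[OF that]])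
        (auto intro!: continuous_intros)
    then show ?thesis using pos by (fastforce intro!: continuous_intros)
  qed
  have F_meas: "F \<in> borel_measurable (lborel \<Otimes>\<^sub>M lborel)"
    unfolding F_def p'_def X_def by measurable
  have F_abs: "(\<lambda>t. \<integral>z. norm (F (t, z)) \<partial>lborel) =
      (\<lambda>t. indicator {l..h} t *\<^sub>R (1 / (s + t * b) * affine_mean (\<lambda>z. \<bar>\<phi> z\<bar>) (\<lambda>x. \<bar>L x\<bar>) (u + t * a) (s + t * b)))"
    by (auto simp: F_def fun_eq_iff indicator_def int_abs_p')
  have abs_kernel: "growth_kernel (\<lambda>z. \<bar>\<phi> z\<bar>) \<alpha> C"
    using cont bound exponent_nonneg by unfold_locales (auto intro!: continuous_intros)
  \<comment> \<open>The inner integral of the norm is a continuous function of \<open>t\<close>, since it is itself an affine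
    mean for the kernel \<open>\<bar>\<phi>\<bar>\<close>.\<close>
  have F_int: "integrable (lborel \<Otimes>\<^sub>M lborel) F"
  proof (rule lborel_pair.Fubini_integrable[OF F_meas])
    show "integrable lborel (\<lambda>t. \<integral>z. norm (F (t, z)) \<partial>lborel)"
      unfolding F_abs
      using borel_integrable_atLeastAtMost'[OF cont_ray[OF abs_kernel weighted_integrable_abs[OF L], of 1]]
      unfolding set_integrable_def .
    show "AE t in lborel. integrable lborel (\<lambda>z. F (t, z))"
      by (auto simp: F_def indicator_def integrable_p')
  qed
  \<comment> \<open>The gauge integral satisfies the fundamental theorem of calculus for every derivative, without
    continuity; it agrees with the Lebesgue integral for those \<open>z\<close> at which the latter exists.\<close>
  have inner: "(\<integral>t. F (t, z) \<partial>lborel) = \<phi> z * p h z - \<phi> z * p l z"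
    if "integrable lborel (\<lambda>t. F (t, z))" for z
  proof -
    have "((\<lambda>t. \<phi> z * p' t z) has_integral \<phi> z * p h z - \<phi> z * p l z) {l..h}"
      using lh by (intro fundamental_theorem_of_calculus)
        (auto simp flip: has_real_derivative_iff_has_vector_derivative
          intro!: DERIV_subset[OF DERIV_cmult[OF der_p]])
    moreover have "set_integrable lborel {l..h} (\<lambda>t. \<phi> z * p' t z)"
      using that by (simp add: set_integrable_def F_def)
    ultimately have "(LINT t:{l..h}|lborel. \<phi> z * p' t z) = \<phi> z * p h z - \<phi> z * p l z"
      using set_borel_integral_eq_integral(2) integral_unique by metis
    then show ?thesis by (simp only: set_lebesgue_integral_def F_def prod.case real_scaleR_def)
  qed
  have hl: "h \<in> {l..h}" "l \<in> {l..h}" using lh by auto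
  have "affine_mean \<phi> g (u + h * a) (s + h * b) - affine_mean \<phi> g (u + l * a) (s + l * b)
      = (\<integral>z. \<phi> z * p h z - \<phi> z * p l z \<partial>lborel)"
    using integrable_p int_p hl by simp
  also have "\<dots> = (\<integral>z. (\<integral>t. F (t, z) \<partial>lborel) \<partial>lborel)"
  proof (rule integral_cong_AE)
    show "AE z in lborel. \<phi> z * p h z - \<phi> z * p l z = (\<integral>t. F (t, z) \<partial>lborel)"
      using lborel_pair.AE_integrable_snd[of "\<lambda>t z. F (t, z)"] F_int inner by (auto elim!: AE_mp)
    show "(\<lambda>z. \<integral>t. F (t, z) \<partial>lborel) \<in> borel_measurable lborel"
      using F_meas by measurable
    show "(\<lambda>z. \<phi> z * p h z - \<phi> z * p l z) \<in> borel_measurable lborel"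
      unfolding p_def X_def by measurable
  qed
  also have "\<dots> = (\<integral>t. (\<integral>z. F (t, z) \<partial>lborel) \<partial>lborel)"
    by (rule lborel_pair.Fubini_integral[of "\<lambda>t z. F (t, z)"]) (use F_int in simp)
  also have "\<dots> = (LINT t:{l..h}|lborel. J t)"
    unfolding set_lebesgue_integral_def
    by (intro Bochner_Integration.integral_cong) (auto simp: F_def indicator_def int_p')
  also have "\<dots> = integral {l..h} J"
    using cont_ray[OF growth_kernel_axioms L, of "-1"]
    by (intro set_borel_integral_eq_integral borel_integrable_atLeastAtMost') (simp add: J_def)
  finally show ?thesis unfolding J_def .
qed

text \<open>
  The integrand in \<open>affine_mean_FTC\<close> is continuous in \<open>t\<close>, so the integral can be differentiated. The
  interval around \<open>r\<close> is chosen so short that the scale \<open>s + t b\<close> stays positive on it.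
\<close>
lemma affine_mean_has_derivative_ray:
  fixes u a s b r :: real and g g' :: "real \<Rightarrow> real"
  assumes der: "\<And>x. (g has_real_derivative g' x) (at x)"
    and g: "weighted_integrable \<alpha> g"
    and Lg: "weighted_integrable \<alpha> (\<lambda>x. b * g x + (a + b * x) * g' x)"
    and pos: "0 < s + r * b"
  shows "((\<lambda>t. affine_mean \<phi> g (u + t * a) (s + t * b)) has_real_derivative
     - (1 / (s + r * b)) * affine_mean \<phi> (\<lambda>x. b * g x + (a + b * x) * g' x) (u + r * a) (s + r * b)) (at r)"
proof -
  define J where "J t = - (1 / (s + t * b)) * affine_mean \<phi> (\<lambda>x. b * g x + (a + b * x) * g' x) (u + t * a) (s + t * b)" for t
  define e where "e = (s + r * b) / (2 * (\<bar>b\<bar> + 1))"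
  have e: "e > 0" using pos by (simp add: e_def)
  have pos': "0 < s + t * b" if "t \<in> {r - e..r + e}" for t
  proof -
    have "\<bar>(t - r) * b\<bar> \<le> e * (\<bar>b\<bar> + 1)"
      unfolding abs_mult using that e by (intro mult_mono) auto
    also have "\<dots> = (s + r * b) / 2" by (simp add: e_def field_simps)
    finally have "\<bar>(t - r) * b\<bar> \<le> (s + r * b) / 2" .
    moreover have "0 < c + y" if "0 < c" "\<bar>y\<bar> \<le> c / 2" for c y :: real
      using that by linarith
    ultimately have "0 < s + r * b + (t - r) * b" using pos by blast
    then show ?thesis by (simp add: algebra_simps)
  qed
  have contJ: "continuous_on {r - e..r + e} J"
  proof -
    have "continuous_on {r - e..r + e} (\<lambda>t. affine_mean \<phi> (\<lambda>x. b * g x + (a + b * x) * g' x) (fst (u + t * a, s + t * b)) (snd (u + t * a, s + t * b)))"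
      by (rule continuous_on_compose2[OF continuous_affine_mean[OF Lg]])
        (auto intro!: continuous_intros)
    then show ?thesis unfolding J_def using pos' by (fastforce intro!: continuous_intros)
  qed
  have "((\<lambda>x. affine_mean \<phi> g (u + (r - e) * a) (s + (r - e) * b) + integral {r - e..x} J) has_real_derivative J r)
      (at r within {r - e..r + e})"
    using e by (auto intro!: derivative_eq_intros integral_has_real_derivative contJ)
  then have "((\<lambda>t. affine_mean \<phi> g (u + t * a) (s + t * b)) has_real_derivative J r) (at r within {r - e..r + e})"
  proof (rule has_field_derivative_transform_within[OF _ e])
    fix t assume t: "t \<in> {r - e..r + e}"
    show "affine_mean \<phi> g (u + (r - e) * a) (s + (r - e) * b) + integral {r - e..t} J = affine_mean \<phi> g (u + t * a) (s + t * b)"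
      using affine_mean_FTC[OF der g Lg, of "r - e" t s u] t pos' unfolding J_def by simp
  qed (use e in auto)
  moreover have "at r within {r - e..r + e} = at r" using e by (intro at_within_interior) auto
  ultimately show ?thesis unfolding J_def by simp
qed

end

lemma growth_kernel_abs_powr:
  assumes "0 < \<alpha>"
  shows "growth_kernel (\<lambda>z. \<bar>z\<bar> powr \<alpha>) \<alpha> 1"
  using assms by unfold_locales (auto intro!: continuous_intros continuous_on_powr')

section \<open>Second-order expansion at a critical point\<close>

text \<open>
  Taylor's theorem with Lagrange remainder on the segment from \<open>(u, s)\<close> to \<open>(u + a, s + b)\<close>. The
  remainder contains the second derivative at an unknown point of the segment, but continuity of the
  coefficients \<open>A\<close>, \<open>B\<close>, \<open>C\<close> at \<open>(u, s)\<close> makes the error small uniformly in the direction.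
\<close>
lemma second_order_expansion_along_rays:
  fixes D A B C :: "real \<Rightarrow> real \<Rightarrow> real" and D1 :: "real \<Rightarrow> real \<Rightarrow> real \<Rightarrow> real" and u s \<rho> :: real
  assumes "0 < \<rho>"
    and D1: "\<And>a b r. \<bar>a\<bar> < \<rho> \<Longrightarrow> \<bar>b\<bar> < \<rho> \<Longrightarrow> 0 \<le> r \<Longrightarrow> r \<le> 1 \<Longrightarrow>
      ((\<lambda>t. D (u + t * a) (s + t * b)) has_real_derivative D1 a b r) (at r)"
    and D2: "\<And>a b r. \<bar>a\<bar> < \<rho> \<Longrightarrow> \<bar>b\<bar> < \<rho> \<Longrightarrow> 0 \<le> r \<Longrightarrow> r \<le> 1 \<Longrightarrow>
      (D1 a b has_real_derivative
        a\<^sup>2 * A (u + r * a) (s + r * b) + a * b * B (u + r * a) (s + r * b) + b\<^sup>2 * C (u + r * a) (s + r * b)) (at r)"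
    and critical: "\<And>a b. D1 a b 0 = 0"
    and cont: "isCont (\<lambda>p. A (fst p) (snd p)) (u, s)" "isCont (\<lambda>p. B (fst p) (snd p)) (u, s)"
      "isCont (\<lambda>p. C (fst p) (snd p)) (u, s)"
    and "0 < \<epsilon>"
  obtains \<delta> where "0 < \<delta>" "\<delta> \<le> \<rho>"
    "\<And>a b. \<bar>a\<bar> < \<delta> \<Longrightarrow> \<bar>b\<bar> < \<delta> \<Longrightarrow>
      \<bar>D (u + a) (s + b) - D u s - (a\<^sup>2 * A u s + a * b * B u s + b\<^sup>2 * C u s) / 2\<bar> \<le> \<epsilon> * (a\<^sup>2 + b\<^sup>2)"
proof -
  have near: "\<exists>d>0. \<forall>a b. \<bar>a\<bar> < d \<longrightarrow> \<bar>b\<bar> < d \<longrightarrow> \<bar>G (u + a) (s + b) - G u s\<bar> < \<epsilon>"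
    if "isCont (\<lambda>p. G (fst p) (snd p)) (u, s)" for G :: "real \<Rightarrow> real \<Rightarrow> real"
  proof -
    have "\<exists>d>0. \<forall>p. dist p (u, s) < d \<longrightarrow> dist (G (fst p) (snd p)) (G (fst (u, s)) (snd (u, s))) < \<epsilon>"
      using that \<open>0 < \<epsilon>\<close> unfolding continuous_at_eps_delta by blast
    then obtain d where d: "d > 0" "\<And>p. dist p (u, s) < d \<Longrightarrow> dist (G (fst p) (snd p)) (G u s) < \<epsilon>"
      unfolding fst_conv snd_conv by blast
    have "\<bar>G (u + a) (s + b) - G u s\<bar> < \<epsilon>" if "\<bar>a\<bar> < d / 2" "\<bar>b\<bar> < d / 2" for a b
    proof -
      have "dist (u + a, s + b) (u, s) \<le> \<bar>a\<bar> + \<bar>b\<bar>"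
        unfolding dist_Pair_Pair dist_real_def using sqrt_sum_squares_le_sum_abs[of a b] by simp
      then show ?thesis using d(2)[of "(u + a, s + b)"] that by (simp add: dist_real_def)
    qed
    then show ?thesis using d(1) by (intro exI[of _ "d / 2"]) auto
  qed
  obtain dA dB dC where d: "dA > 0" "dB > 0" "dC > 0"
    and dA: "\<And>a b. \<bar>a\<bar> < dA \<Longrightarrow> \<bar>b\<bar> < dA \<Longrightarrow> \<bar>A (u + a) (s + b) - A u s\<bar> < \<epsilon>"
    and dB: "\<And>a b. \<bar>a\<bar> < dB \<Longrightarrow> \<bar>b\<bar> < dB \<Longrightarrow> \<bar>B (u + a) (s + b) - B u s\<bar> < \<epsilon>"
    and dC: "\<And>a b. \<bar>a\<bar> < dC \<Longrightarrow> \<bar>b\<bar> < dC \<Longrightarrow> \<bar>C (u + a) (s + b) - C u s\<bar> < \<epsilon>"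
    using near[OF cont(1)] near[OF cont(2)] near[OF cont(3)] by metis
  define \<delta> where "\<delta> = Min {\<rho>, dA, dB, dC}"
  show thesis
  proof (rule that[of \<delta>])
    show "0 < \<delta>" "\<delta> \<le> \<rho>" using d \<open>0 < \<rho>\<close> by (auto simp: \<delta>_def)
    fix a b :: real
    assume ab: "\<bar>a\<bar> < \<delta>" "\<bar>b\<bar> < \<delta>"
    define q where "q r = a\<^sup>2 * A (u + r * a) (s + r * b) + a * b * B (u + r * a) (s + r * b)
      + b\<^sup>2 * C (u + r * a) (s + r * b)" for r
    define diff where "diff m = (if m = 0 then \<lambda>t. D (u + t * a) (s + t * b) else if m = 1 then D1 a b else q)" for m :: nat
    have ab': "\<bar>a\<bar> < \<rho>" "\<bar>b\<bar> < \<rho>" using ab by (auto simp: \<delta>_def)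
    have "\<exists>t. 0 < t \<and> t < 1 \<and> D (u + 1 * a) (s + 1 * b)
        = (\<Sum>m<2. diff m 0 / fact m * (1 - 0) ^ m) + diff 2 t / fact 2 * (1 - 0)\<^sup>2"
    proof (rule Taylor_up)
      show "\<forall>m t. m < 2 \<and> 0 \<le> t \<and> t \<le> 1 \<longrightarrow> (diff m has_real_derivative diff (Suc m) t) (at t)"
        using D1[OF ab'] D2[OF ab'] by (auto simp: diff_def q_def less_2_cases_iff)
    qed (auto simp: diff_def)
    then obtain t where t: "0 < t" "t < 1" and "D (u + a) (s + b) = D u s + q t / 2"
      by (auto simp: diff_def numeral_2_eq_2 critical)
    moreover have "\<bar>q t - q 0\<bar> \<le> 2 * \<epsilon> * (a\<^sup>2 + b\<^sup>2)"
    proof -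
      have "\<bar>t * a\<bar> \<le> \<bar>a\<bar>" "\<bar>t * b\<bar> \<le> \<bar>b\<bar>" using t by (auto simp: abs_mult mult_left_le_one_le)
      then have *: "\<bar>t * a\<bar> < \<delta>" "\<bar>t * b\<bar> < \<delta>" using ab by linarith+
      then have eA: "\<bar>A (u + t * a) (s + t * b) - A u s\<bar> \<le> \<epsilon>" and eB: "\<bar>B (u + t * a) (s + t * b) - B u s\<bar> \<le> \<epsilon>"
        and eC: "\<bar>C (u + t * a) (s + t * b) - C u s\<bar> \<le> \<epsilon>"
        using dA[of "t * a" "t * b"] dB[of "t * a" "t * b"] dC[of "t * a" "t * b"] by (auto simp: \<delta>_def)
      have "q t - q 0 = a\<^sup>2 * (A (u + t * a) (s + t * b) - A u s) + a * b * (B (u + t * a) (s + t * b) - B u s)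
          + b\<^sup>2 * (C (u + t * a) (s + t * b) - C u s)"
        by (simp add: q_def algebra_simps)
      also have "\<bar>\<dots>\<bar> \<le> \<bar>a\<^sup>2 * (A (u + t * a) (s + t * b) - A u s)\<bar> + \<bar>a * b * (B (u + t * a) (s + t * b) - B u s)\<bar>
          + \<bar>b\<^sup>2 * (C (u + t * a) (s + t * b) - C u s)\<bar>"
        by linarith
      also have "\<dots> \<le> a\<^sup>2 * \<epsilon> + \<bar>a * b\<bar> * \<epsilon> + b\<^sup>2 * \<epsilon>"
        unfolding abs_mult[of "a\<^sup>2"] abs_mult[of "a * b"] abs_mult[of "b\<^sup>2"]
        by (intro add_mono mult_mono eA eB eC) auto
      also have "\<dots> \<le> 2 * \<epsilon> * (a\<^sup>2 + b\<^sup>2)"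
      proof -
        have "2 * \<bar>a * b\<bar> \<le> a\<^sup>2 + b\<^sup>2"
          using sum_squares_bound[of "\<bar>a\<bar>" "\<bar>b\<bar>"] by (simp add: abs_mult)
        then have "\<bar>a * b\<bar> \<le> a\<^sup>2 + b\<^sup>2" by linarith
        then have "\<bar>a * b\<bar> * \<epsilon> \<le> (a\<^sup>2 + b\<^sup>2) * \<epsilon>" using \<open>0 < \<epsilon>\<close> by (intro mult_right_mono) auto
        then show ?thesis by (simp add: algebra_simps)
      qed
      finally show ?thesis .
    qed
    moreover have "\<bar>x / 2 - y / 2\<bar> \<le> e" if "\<bar>x - y\<bar> \<le> 2 * e" for x y e :: real
      using that by linarith
    ultimately have "\<bar>D (u + a) (s + b) - D u s - q 0 / 2\<bar> \<le> \<epsilon> * (a\<^sup>2 + b\<^sup>2)"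
      by (simp add: mult.assoc)
    then show "\<bar>D (u + a) (s + b) - D u s - (a\<^sup>2 * A u s + a * b * B u s + b\<^sup>2 * C u s) / 2\<bar> \<le> \<epsilon> * (a\<^sup>2 + b\<^sup>2)"
      by (simp add: q_def)
  qed
qed

section \<open>Twice differentiable densities\<close>

lemma lborel_integral_pos:
  fixes h :: "real \<Rightarrow> real"
  assumes h: "integrable lborel h" and pos: "\<And>x. x \<noteq> c \<Longrightarrow> 0 < h x" and "0 \<le> h c"
  shows "0 < (\<integral>x. h x \<partial>lborel)"
proof -
  have nonneg: "0 \<le> h x" for x using pos[of x] \<open>0 \<le> h c\<close> by (cases "x = c") auto
  have "(\<integral>x. h x \<partial>lborel) \<noteq> 0"
  proof
    assume "(\<integral>x. h x \<partial>lborel) = 0"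
    then have "AE x in lborel. h x = 0"
      using integral_nonneg_eq_0_iff_AE[OF h] nonneg by simp
    moreover have "AE x in lborel. x \<noteq> c" by (rule AE_lborel_singleton)
    ultimately have "AE x in (lborel :: real measure). False"
      by eventually_elim (use pos in force)
    then have "emeasure lborel (UNIV :: real set) = 0" by (simp add: AE_iff_measurable[OF _ refl])
    then show False by simp
  qed
  moreover have "0 \<le> (\<integral>x. h x \<partial>lborel)" using nonneg by (intro integral_nonneg_AE) auto
  ultimately show ?thesis by simp
qed

text \<open>
  The functions witnessing the regularity assumption on the base measure are fixed here, so that
  integrals can be written in terms of them.
\<close>
locale smooth_density = prob_space Q for Q :: "real measure" +
  fixes \<alpha> :: real and \<Psi> \<Psi>' \<Psi>'' :: "real \<Rightarrow> real"
  assumes exponent_pos: "0 < \<alpha>"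
    and \<Psi>': "\<And>x. (\<Psi> has_real_derivative \<Psi>' x) (at x)"
    and \<Psi>'': "\<And>x. (\<Psi>' has_real_derivative \<Psi>'' x) (at x)"
    and density: "Q = density lborel (\<lambda>x. ennreal (exp (\<Psi> x)))"
    and integrable_\<Psi>': "integrable Q \<Psi>'"
    and integrable_\<Psi>'': "integrable Q \<Psi>''"
    and integrable_\<Psi>'_sq: "integrable Q (\<lambda>x. (\<Psi>' x)\<^sup>2)"
    and integrable_powr: "integrable Q (\<lambda>x. \<bar>x\<bar> powr \<alpha>)"
    and integrable_powr_\<Psi>': "integrable Q (\<lambda>x. \<bar>x\<bar> powr (\<alpha> + 1) * \<Psi>' x)"
    and integrable_powr_\<Psi>'': "integrable Q (\<lambda>x. \<bar>x\<bar> powr (\<alpha> + 3) * \<Psi>'' x)"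
    and integrable_powr_\<Psi>'_sq: "integrable Q (\<lambda>x. \<bar>x\<bar> powr (\<alpha> + 3) * (\<Psi>' x)\<^sup>2)"
begin

abbreviation f :: "real \<Rightarrow> real" where "f x \<equiv> exp (\<Psi> x)"

text \<open>
  This is \<open>f'' / f\<close>: the relative second derivative of the density.
\<close>
definition q :: "real \<Rightarrow> real" where "q x = \<Psi>'' x + (\<Psi>' x)\<^sup>2"

lemma sets_Q [measurable_cong, simp]: "sets Q = sets borel"
  by (subst density) simp

lemma space_Q [simp]: "space Q = UNIV"
  by (subst density) simp

lemma measurable_f [measurable]: "f \<in> borel_measurable borel"
proof -
  have "continuous_on UNIV \<Psi>"
    using \<Psi>' DERIV_isCont continuous_at_imp_continuous_on by blast
  then have [measurable]: "\<Psi> \<in> borel_measurable borel"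
    by (rule borel_measurable_continuous_onI)
  show ?thesis by measurable
qed

lemma measurable_\<Psi>' [measurable]: "\<Psi>' \<in> borel_measurable borel"
  and measurable_q [measurable]: "q \<in> borel_measurable borel"
proof -
  show *: "\<Psi>' \<in> borel_measurable borel"
    using borel_measurable_integrable[OF integrable_\<Psi>'] by measurable
  have "\<Psi>'' \<in> borel_measurable borel"
    using borel_measurable_integrable[OF integrable_\<Psi>''] by measurable
  with * show "q \<in> borel_measurable borel" unfolding q_def by measurable
qed

lemma integrable_Q_iff:
  assumes [measurable]: "h \<in> borel_measurable borel"
  shows "integrable Q h \<longleftrightarrow> integrable lborel (\<lambda>x. h x * f x)"
  by (subst density, subst integrable_density) (auto simp: mult.commute)

lemma integral_Q:
  fixes h :: "real \<Rightarrow> real"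
  assumes [measurable]: "h \<in> borel_measurable borel"
  shows "(\<integral>x. h x \<partial>Q) = (\<integral>x. h x * f x \<partial>lborel)"
  by (subst density, subst integral_density) (auto simp: mult.commute)

lemma weighted_integrable_Q_iff:
  assumes [measurable]: "c \<in> borel_measurable borel"
  shows "weighted_integrable \<alpha> (\<lambda>x. c x * f x) \<longleftrightarrow> integrable Q (\<lambda>x. (1 + \<bar>x\<bar> powr \<alpha>) * c x)"
  unfolding weighted_integrable_def by (subst integrable_Q_iff) (auto simp: mult.assoc)

text \<open>
  For \<open>\<bar>x\<bar> \<ge> 1\<close> the weight times \<open>\<bar>x\<bar> ^ j\<close> is at most \<open>2 * \<bar>x\<bar> powr p\<close>, and for \<open>\<bar>x\<bar> \<le> 1\<close> it is at most
  2. Hence one moment of high order and integrability of \<open>c\<close> itself control all lower powers.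
\<close>
lemma weighted_integrable_power_mult:
  assumes c: "integrable Q c" and pc: "integrable Q (\<lambda>x. \<bar>x\<bar> powr p * c x)" and p: "\<alpha> + real j \<le> p"
  shows "weighted_integrable \<alpha> (\<lambda>x. x ^ j * c x * f x)"
proof -
  have [measurable]: "c \<in> borel_measurable borel"
    using borel_measurable_integrable[OF c] by measurable
  have "integrable Q (\<lambda>x. (1 + \<bar>x\<bar> powr \<alpha>) * (x ^ j * c x))"
  proof (rule Bochner_Integration.integrable_bound)
    show "integrable Q (\<lambda>x. 2 * (\<bar>c x\<bar> + \<bar>\<bar>x\<bar> powr p * c x\<bar>))"
      using c pc by (intro integrable_mult_right Bochner_Integration.integrable_add integrable_abs)
    show "(\<lambda>x. (1 + \<bar>x\<bar> powr \<alpha>) * (x ^ j * c x)) \<in> borel_measurable Q" by measurable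
    have small: "(1 + \<bar>x\<bar> powr \<alpha>) * \<bar>x\<bar> ^ j \<le> 2 * (1 + \<bar>x\<bar> powr p)" for x :: real
    proof (cases "\<bar>x\<bar> \<le> 1")
      case True
      have "\<bar>x\<bar> powr \<alpha> \<le> 1" using True exponent_pos powr_mono2[of \<alpha> "\<bar>x\<bar>" 1] by simp
      moreover have "\<bar>x\<bar> ^ j \<le> 1" using True by (intro power_le_one) auto
      ultimately have "(1 + \<bar>x\<bar> powr \<alpha>) * \<bar>x\<bar> ^ j \<le> (1 + 1) * 1" by (intro mult_mono) auto
      also have "\<dots> \<le> 2 * (1 + \<bar>x\<bar> powr p)" by simp
      finally show ?thesis .
    next
      case False
      then have "\<bar>x\<bar> ^ j = \<bar>x\<bar> powr j" by (simp add: powr_realpow)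
      moreover have "\<bar>x\<bar> powr j \<le> \<bar>x\<bar> powr p" "\<bar>x\<bar> powr (\<alpha> + j) \<le> \<bar>x\<bar> powr p"
        using False p exponent_pos by (auto intro!: powr_mono)
      ultimately show ?thesis by (simp add: distrib_right flip: powr_add)
    qed
    have "norm ((1 + \<bar>x\<bar> powr \<alpha>) * (x ^ j * c x)) \<le> norm (2 * (\<bar>c x\<bar> + \<bar>\<bar>x\<bar> powr p * c x\<bar>))" for x
    proof -
      have "norm ((1 + \<bar>x\<bar> powr \<alpha>) * (x ^ j * c x)) = (1 + \<bar>x\<bar> powr \<alpha>) * \<bar>x\<bar> ^ j * \<bar>c x\<bar>"
        by (simp add: abs_mult power_abs)
      also have "\<dots> \<le> 2 * (1 + \<bar>x\<bar> powr p) * \<bar>c x\<bar>"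
        by (intro mult_right_mono small) auto
      also have "\<dots> = norm (2 * (\<bar>c x\<bar> + \<bar>\<bar>x\<bar> powr p * c x\<bar>))"
        by (simp add: abs_mult distrib_right)
      finally show ?thesis .
    qed
    then show "AE x in Q. norm ((1 + \<bar>x\<bar> powr \<alpha>) * (x ^ j * c x)) \<le> norm (2 * (\<bar>c x\<bar> + \<bar>\<bar>x\<bar> powr p * c x\<bar>))"
      by blast
  qed
  then show ?thesis by (subst weighted_integrable_Q_iff) auto
qed

lemma weighted_integrable_density_derivatives:
  shows weighted_f: "weighted_integrable \<alpha> f"
    and weighted_\<Psi>': "j \<le> 1 \<Longrightarrow> weighted_integrable \<alpha> (\<lambda>x. x ^ j * \<Psi>' x * f x)"
    and weighted_q: "j \<le> 2 \<Longrightarrow> weighted_integrable \<alpha> (\<lambda>x. x ^ j * q x * f x)"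
proof -
  show "weighted_integrable \<alpha> f"
    using weighted_integrable_power_mult[of "\<lambda>_. 1" \<alpha> 0] integrable_powr by simp
  show "weighted_integrable \<alpha> (\<lambda>x. x ^ j * \<Psi>' x * f x)" if "j \<le> 1"
    using weighted_integrable_power_mult[OF integrable_\<Psi>' integrable_powr_\<Psi>'] that by simp
  have "integrable Q (\<lambda>x. \<bar>x\<bar> powr (\<alpha> + 3) * q x)"
    using Bochner_Integration.integrable_add[OF integrable_powr_\<Psi>'' integrable_powr_\<Psi>'_sq]
    by (simp add: q_def distrib_left)
  moreover have "integrable Q q"
    unfolding q_def using integrable_\<Psi>'' integrable_\<Psi>'_sq by simp
  ultimately show "weighted_integrable \<alpha> (\<lambda>x. x ^ j * q x * f x)" if "j \<le> 2"
    using weighted_integrable_power_mult[of q "\<alpha> + 3" j] that by simp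
qed

text \<open>
  Integrating \<open>Y\<close> out first leaves a function of one variable that inherits the continuity and the
  growth of the kernel.
\<close>
definition \<phi> :: "real \<Rightarrow> real" where "\<phi> z = (\<integral>y. \<bar>z - y\<bar> powr \<alpha> \<partial>Q)"

lemma kernel_integrable: "integrable Q (\<lambda>y. \<bar>z - y\<bar> powr \<alpha>)"
  and \<phi>_eq: "\<phi> z = affine_mean (\<lambda>w. \<bar>w\<bar> powr \<alpha>) f z (- 1)"
proof -
  interpret P: growth_kernel "\<lambda>w. \<bar>w\<bar> powr \<alpha>" \<alpha> 1
    by (rule growth_kernel_abs_powr[OF exponent_pos])
  show "integrable Q (\<lambda>y. \<bar>z - y\<bar> powr \<alpha>)"
    using P.integrable_affine[OF weighted_f, of z "-1"] by (subst integrable_Q_iff) auto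
  show "\<phi> z = affine_mean (\<lambda>w. \<bar>w\<bar> powr \<alpha>) f z (- 1)"
    unfolding \<phi>_def affine_mean_def by (subst integral_Q) auto
qed

lemma \<phi>_nonneg: "0 \<le> \<phi> z"
  unfolding \<phi>_def by (intro integral_nonneg_AE) auto

lemma \<phi>_pos: "0 < \<phi> z"
proof -
  have "0 < (\<integral>y. \<bar>z - y\<bar> powr \<alpha> * f y \<partial>lborel)"
    using kernel_integrable[of z] by (intro lborel_integral_pos[where c = z]) (auto simp: integrable_Q_iff)
  then show ?thesis unfolding \<phi>_def by (subst integral_Q) auto
qed

sublocale growth_kernel \<phi> \<alpha> "2 powr \<alpha> * (1 + (\<integral>y. \<bar>y\<bar> powr \<alpha> \<partial>Q))"
proof
  interpret P: growth_kernel "\<lambda>w. \<bar>w\<bar> powr \<alpha>" \<alpha> 1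
    by (rule growth_kernel_abs_powr[OF exponent_pos])
  have "continuous_on UNIV (\<lambda>z. affine_mean (\<lambda>w. \<bar>w\<bar> powr \<alpha>) f (fst (z, -1::real)) (snd (z, -1::real)))"
    by (rule continuous_on_compose2[OF P.continuous_affine_mean[OF weighted_f]]) (auto intro!: continuous_intros)
  then show "continuous_on UNIV \<phi>" by (simp add: \<phi>_eq[abs_def])
  show "0 \<le> \<alpha>" using exponent_pos by simp
  fix z
  have "\<bar>z - y\<bar> powr \<alpha> \<le> 2 powr \<alpha> * (1 + \<bar>z\<bar> powr \<alpha>) * (1 + \<bar>y\<bar> powr \<alpha>)" for y
  proof -
    have "\<bar>z - y\<bar> powr \<alpha> \<le> (\<bar>y\<bar> + 1) powr \<alpha> * (1 + \<bar>z\<bar> powr \<alpha>)"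
      using powr_abs_affine_le[of \<alpha> "- y" 1 z] exponent_pos by simp
    also have "\<dots> \<le> 2 powr \<alpha> * (1 + \<bar>y\<bar> powr \<alpha>) * (1 + \<bar>z\<bar> powr \<alpha>)"
      using powr_abs_affine_le[of \<alpha> 1 1 "\<bar>y\<bar>"] exponent_pos
      by (intro mult_right_mono) (simp_all add: add.commute)
    finally show ?thesis by (simp only: mult_ac)
  qed
  then have "\<phi> z \<le> (\<integral>y. 2 powr \<alpha> * (1 + \<bar>z\<bar> powr \<alpha>) * (1 + \<bar>y\<bar> powr \<alpha>) \<partial>Q)"
    unfolding \<phi>_def using integrable_powr kernel_integrable by (intro integral_mono) auto
  also have "\<dots> = 2 powr \<alpha> * (1 + (\<integral>y. \<bar>y\<bar> powr \<alpha> \<partial>Q)) * (1 + \<bar>z\<bar> powr \<alpha>)"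
    using integrable_powr by (simp add: prob_space[unfolded space_Q])
  finally show "\<bar>\<phi> z\<bar> \<le> 2 powr \<alpha> * (1 + (\<integral>y. \<bar>y\<bar> powr \<alpha> \<partial>Q)) * (1 + \<bar>z\<bar> powr \<alpha>)"
    using \<phi>_nonneg[of z] by simp
qed

sublocale QQ: pair_prob_space Q Q ..

text \<open>
  This translates between expectations over the independent pair and the one-dimensional integrals
  that can be differentiated.
\<close>
lemma pair_kernel_integrable:
  assumes c: "weighted_integrable \<alpha> (\<lambda>x. c x * f x)" and [measurable]: "c \<in> borel_measurable borel"
  shows "integrable (Q \<Otimes>\<^sub>M Q) (\<lambda>(x, y). \<bar>u + s * x - y\<bar> powr \<alpha> * c x)"
    and "(\<integral>(x, y). \<bar>u + s * x - y\<bar> powr \<alpha> * c x \<partial>(Q \<Otimes>\<^sub>M Q)) = affine_mean \<phi> (\<lambda>x. c x * f x) u s"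
proof -
  let ?k = "\<lambda>(x, y). \<bar>u + s * x - y\<bar> powr \<alpha> * c x"
  have int: "integrable Q (\<lambda>x. \<phi> (u + s * x) * c x)"
    using integrable_affine[OF c, of u s] by (subst integrable_Q_iff) (auto simp: mult.assoc)
  show k: "integrable (Q \<Otimes>\<^sub>M Q) ?k"
  proof (rule QQ.Fubini_integrable)
    show "?k \<in> borel_measurable (Q \<Otimes>\<^sub>M Q)" by measurable
    have "(\<lambda>x. \<integral>y. norm (?k (x, y)) \<partial>Q) = (\<lambda>x. \<bar>\<phi> (u + s * x) * c x\<bar>)"
      using \<phi>_nonneg by (auto simp: abs_mult \<phi>_def fun_eq_iff)
    then show "integrable Q (\<lambda>x. \<integral>y. norm (?k (x, y)) \<partial>Q)" using int by simp
    show "AE x in Q. integrable Q (\<lambda>y. ?k (x, y))" using kernel_integrable by simp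
  qed
  have "(\<integral>z. ?k z \<partial>(Q \<Otimes>\<^sub>M Q)) = (\<integral>x. \<integral>y. ?k (x, y) \<partial>Q \<partial>Q)"
    by (rule QQ.integral_fst'[OF k, symmetric])
  also have "\<dots> = (\<integral>x. \<phi> (u + s * x) * c x \<partial>Q)" by (simp add: \<phi>_def)
  also have "\<dots> = affine_mean \<phi> (\<lambda>x. c x * f x) u s"
    unfolding affine_mean_def by (subst integral_Q) (auto simp: mult.assoc)
  finally show "(\<integral>z. ?k z \<partial>(Q \<Otimes>\<^sub>M Q)) = affine_mean \<phi> (\<lambda>x. c x * f x) u s" .
qed

section \<open>The cross moment and its derivatives\<close>

text \<open>
  The cross moment: the expectation of \<open>\<bar>u + s X - Y\<bar> powr \<alpha>\<close> for independent \<open>X\<close>, \<open>Y\<close> with law \<open>Q\<close>.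
\<close>
definition m :: "real \<Rightarrow> real \<Rightarrow> real" where "m = affine_mean \<phi> f"

lemma m_eq: "m u s = (\<integral>(x, y). \<bar>u + s * x - y\<bar> powr \<alpha> \<partial>(Q \<Otimes>\<^sub>M Q))"
  and m_integrable: "integrable (Q \<Otimes>\<^sub>M Q) (\<lambda>(x, y). \<bar>u + s * x - y\<bar> powr \<alpha>)"
  using pair_kernel_integrable[of "\<lambda>_. 1" u s] weighted_f by (auto simp: m_def)

abbreviation K :: real where "K \<equiv> kernel_moment \<alpha> Q"

lemma m_at_base: "m 0 1 = K"
  by (simp add: m_eq kernel_moment_def)

lemma K_pos: "0 < K"
proof -
  have "0 < (\<integral>x. \<phi> x * f x \<partial>lborel)"
    using integrable_affine[OF weighted_f, of 0 1] \<phi>_pos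
    by (intro lborel_integral_pos[where c = 0]) (auto simp: less_imp_le)
  then show ?thesis using m_at_base by (simp add: m_def affine_mean_def)
qed

text \<open>
  Exchanging \<open>X\<close> and \<open>Y\<close> turns \<open>u + s X - Y\<close> into \<open>u + s Y - X = - s (X / s - u / s - Y)\<close>. This symmetry
  determines the gradient of \<open>m\<close> at \<open>(0, 1)\<close>.
\<close>
lemma m_swap:
  assumes s: "0 < s"
  shows "m u s = s powr \<alpha> * m (- u / s) (1 / s)"
proof -
  have "m u s = (\<integral>(x, y). \<bar>u + s * y - x\<bar> powr \<alpha> \<partial>(Q \<Otimes>\<^sub>M Q))"
    unfolding m_eq
    using QQ.integral_product_swap[of "\<lambda>(x, y). \<bar>u + s * x - y\<bar> powr \<alpha>"] m_integrable
    by (simp add: case_prod_unfold borel_measurable_integrable)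
  also have "\<dots> = (\<integral>(x, y). s powr \<alpha> * \<bar>- u / s + 1 / s * x - y\<bar> powr \<alpha> \<partial>(Q \<Otimes>\<^sub>M Q))"
  proof -
    have "\<bar>u + s * y - x\<bar> = s * \<bar>- u / s + 1 / s * x - y\<bar>" for x y
    proof -
      have "s * \<bar>- u / s + 1 / s * x - y\<bar> = \<bar>s * (- u / s + 1 / s * x - y)\<bar>"
        using s by (simp add: abs_mult)
      also have "s * (- u / s + 1 / s * x - y) = - (u + s * y - x)" using s by (simp add: field_simps)
      finally show ?thesis by (simp only: abs_minus_cancel)
    qed
    then show ?thesis using s by (simp add: powr_mult)
  qed
  also have "\<dots> = s powr \<alpha> * m (- u / s) (1 / s)"
    unfolding m_eq by (simp add: case_prod_unfold)
  finally show ?thesis .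
qed

text \<open>
  The moments of \<open>\<phi> (u + s x)\<close> against \<open>x ^ j f' x\<close> and \<open>x ^ j f'' x\<close>, in terms of which the derivatives
  of \<open>m\<close> are expressed.
\<close>
abbreviation m1 :: "nat \<Rightarrow> real \<Rightarrow> real \<Rightarrow> real" where
  "m1 j \<equiv> affine_mean \<phi> (\<lambda>x. x ^ j * \<Psi>' x * f x)"

abbreviation m2 :: "nat \<Rightarrow> real \<Rightarrow> real \<Rightarrow> real" where
  "m2 j \<equiv> affine_mean \<phi> (\<lambda>x. x ^ j * q x * f x)"

lemma f_has_derivative: "(f has_real_derivative \<Psi>' x * f x) (at x)"
  using \<Psi>' by (auto intro!: derivative_eq_intros)

lemma \<Psi>'_f_has_derivative: "((\<lambda>x. \<Psi>' x * f x) has_real_derivative q x * f x) (at x)"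
  using \<Psi>' \<Psi>'' by (auto intro!: derivative_eq_intros simp: q_def algebra_simps power2_eq_square)

lemma m_ray_derivative:
  assumes pos: "0 < 1 + r * b"
  shows "((\<lambda>t. m (t * a) (1 + t * b)) has_real_derivative
    - (b * m (r * a) (1 + r * b) + a * m1 0 (r * a) (1 + r * b) + b * m1 1 (r * a) (1 + r * b)) / (1 + r * b)) (at r)"
proof -
  have eq: "(\<lambda>x. b * f x + (a + b * x) * (\<Psi>' x * f x))
      = (\<lambda>x. b * f x + (a * (x ^ 0 * \<Psi>' x * f x) + b * (x ^ 1 * \<Psi>' x * f x)))"
    by (simp add: fun_eq_iff algebra_simps)
  have w0: "weighted_integrable \<alpha> (\<lambda>x. x ^ 0 * \<Psi>' x * f x)"
    and w1: "weighted_integrable \<alpha> (\<lambda>x. x ^ 1 * \<Psi>' x * f x)"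
    by (rule weighted_\<Psi>'; simp)+
  note w = weighted_f w0 w1
  have L: "weighted_integrable \<alpha> (\<lambda>x. b * f x + (a + b * x) * (\<Psi>' x * f x))"
    unfolding eq by (intro weighted_integrable_add weighted_integrable_mult_left w)
  have "affine_mean \<phi> (\<lambda>x. b * f x + (a + b * x) * (\<Psi>' x * f x)) u s = b * m u s + (a * m1 0 u s + b * m1 1 u s)" for u s
    unfolding eq m_def
    by (simp only: affine_mean_add affine_mean_cmult weighted_integrable_add weighted_integrable_mult_left w)
  note mean = this
  have "((\<lambda>t. m (t * a) (1 + t * b)) has_real_derivative - (1 / (1 + r * b))
      * affine_mean \<phi> (\<lambda>x. b * f x + (a + b * x) * (\<Psi>' x * f x)) (r * a) (1 + r * b)) (at r)"
    using affine_mean_has_derivative_ray[OF f_has_derivative weighted_f L pos, of 0]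
    unfolding m_def add_0_left .
  then show ?thesis
    unfolding mean by (rule DERIV_cong) (simp add: add_divide_distrib diff_divide_distrib)
qed

text \<open>
  The first derivative along the ray is, up to the factor \<open>- 1 / (1 + r * b)\<close>, the affine mean of
  \<open>((a + b x) f)'\<close>. Applying \<open>affine_mean_has_derivative_ray\<close> to this function in place of \<open>f\<close> produces
  the coefficients below.
\<close>
lemma m_ray_second_derivative:
  assumes pos: "0 < 1 + r * b"
  shows "((\<lambda>t. b * m (t * a) (1 + t * b) + a * m1 0 (t * a) (1 + t * b) + b * m1 1 (t * a) (1 + t * b))
    has_real_derivative
      - (b\<^sup>2 * m (r * a) (1 + r * b) + 3 * a * b * m1 0 (r * a) (1 + r * b) + 3 * b\<^sup>2 * m1 1 (r * a) (1 + r * b)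
       + a\<^sup>2 * m2 0 (r * a) (1 + r * b) + 2 * a * b * m2 1 (r * a) (1 + r * b) + b\<^sup>2 * m2 2 (r * a) (1 + r * b))
      / (1 + r * b)) (at r)"
proof -
  have w0: "weighted_integrable \<alpha> (\<lambda>x. x ^ 0 * \<Psi>' x * f x)"
    and w1: "weighted_integrable \<alpha> (\<lambda>x. x ^ 1 * \<Psi>' x * f x)"
    by (rule weighted_\<Psi>'; simp)+
  have w2: "weighted_integrable \<alpha> (\<lambda>x. x ^ 0 * q x * f x)"
    and w3: "weighted_integrable \<alpha> (\<lambda>x. x ^ 1 * q x * f x)"
    and w4: "weighted_integrable \<alpha> (\<lambda>x. x ^ 2 * q x * f x)"
    by (rule weighted_q; simp)+
  note w = weighted_f w0 w1 w2 w3 w4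
  define g where "g x = b * f x + (a * (x ^ 0 * \<Psi>' x * f x) + b * (x ^ 1 * \<Psi>' x * f x))" for x
  define g' where "g' x = 2 * b * (\<Psi>' x * f x) + (a + b * x) * (q x * f x)" for x
  have g: "weighted_integrable \<alpha> g"
    unfolding g_def by (intro weighted_integrable_add weighted_integrable_mult_left w)
  have g_mean: "affine_mean \<phi> g u s = b * m u s + (a * m1 0 u s + b * m1 1 u s)" for u s
    unfolding g_def m_def
    by (simp only: affine_mean_add affine_mean_cmult weighted_integrable_add weighted_integrable_mult_left w)
  have g': "(g has_real_derivative g' x) (at x)" for x
  proof -
    have "g = (\<lambda>x. b * f x + (a + b * x) * (\<Psi>' x * f x))"
      by (simp add: g_def fun_eq_iff algebra_simps)
    moreover have "((\<lambda>x. a + b * x) has_real_derivative b) (at x)"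
      by (auto intro!: derivative_eq_intros)
    then have "((\<lambda>x. b * f x + (a + b * x) * (\<Psi>' x * f x)) has_real_derivative
        b * (\<Psi>' x * f x) + (b * (\<Psi>' x * f x) + (q x * f x) * (a + b * x))) (at x)"
      by (intro DERIV_add DERIV_cmult DERIV_mult f_has_derivative \<Psi>'_f_has_derivative)
    ultimately show ?thesis unfolding g'_def by (simp add: algebra_simps)
  qed
  have eq: "(\<lambda>x. b * g x + (a + b * x) * g' x)
      = (\<lambda>x. b\<^sup>2 * f x + (3 * a * b * (x ^ 0 * \<Psi>' x * f x) + (3 * b\<^sup>2 * (x ^ 1 * \<Psi>' x * f x)
       + (a\<^sup>2 * (x ^ 0 * q x * f x) + (2 * a * b * (x ^ 1 * q x * f x) + b\<^sup>2 * (x ^ 2 * q x * f x))))))"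
    by (simp add: fun_eq_iff g_def g'_def algebra_simps power2_eq_square)
  have L: "weighted_integrable \<alpha> (\<lambda>x. b * g x + (a + b * x) * g' x)"
    unfolding eq by (intro weighted_integrable_add weighted_integrable_mult_left w)
  have "affine_mean \<phi> (\<lambda>x. b * g x + (a + b * x) * g' x) u s = b\<^sup>2 * m u s + (3 * a * b * m1 0 u s + (3 * b\<^sup>2 * m1 1 u s
      + (a\<^sup>2 * m2 0 u s + (2 * a * b * m2 1 u s + b\<^sup>2 * m2 2 u s))))" for u s
    unfolding eq m_def
    by (simp only: affine_mean_add affine_mean_cmult weighted_integrable_add weighted_integrable_mult_left w)
  note mean = this
  have "((\<lambda>t. affine_mean \<phi> g (t * a) (1 + t * b)) has_real_derivative - (1 / (1 + r * b))
      * affine_mean \<phi> (\<lambda>x. b * g x + (a + b * x) * g' x) (r * a) (1 + r * b)) (at r)"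
    using affine_mean_has_derivative_ray[OF g' g L pos, of 0] unfolding add_0_left .
  then show ?thesis
    unfolding mean g_mean add.assoc by (rule DERIV_cong) (simp add: add_divide_distrib diff_divide_distrib)
qed

text \<open>
  By \<open>m_swap\<close> with \<open>s = 1\<close>, the cross moment is an even function of the shift.
\<close>
lemma m1_0_at_base: "m1 0 0 1 = 0"
proof -
  have d: "((\<lambda>t. m t 1) has_real_derivative - m1 0 0 1) (at 0)"
    using m_ray_derivative[of 0 0 1] by simp
  have "((\<lambda>t. m (- t) 1) has_real_derivative - (- m1 0 0 1)) (at 0)"
    using DERIV_mirror[of "\<lambda>t. m t 1" "- m1 0 0 1" 0] d by simp
  moreover have "m (- t) 1 = m t 1" for t
    by (subst (2) m_swap) simp_all
  ultimately have "((\<lambda>t. m t 1) has_real_derivative m1 0 0 1) (at 0)" by simp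
  with d have "- m1 0 0 1 = m1 0 0 1" by (rule DERIV_unique)
  then show ?thesis by simp
qed

text \<open>
  Differentiating \<open>m 0 s = s powr \<alpha> * m 0 (1 / s)\<close> at \<open>s = 1\<close> shows that the derivative there, which is
  \<open>- (K + m1 1 0 1)\<close>, equals \<open>\<alpha> K\<close> minus itself.
\<close>
lemma m1_1_at_base: "K + m1 1 0 1 = - (\<alpha> / 2) * K"
proof -
  let ?c = "K + m1 1 0 1"
  have d: "((\<lambda>t. m 0 (1 + t)) has_real_derivative - ?c) (at 0)"
    using m_ray_derivative[of 0 1 0] by (simp add: m_at_base)
  then have d1: "((\<lambda>s. m 0 s) has_real_derivative - ?c) (at 1)"
    using DERIV_at_within_shift[of "\<lambda>s. m 0 s" "- ?c" 1 0 UNIV] by simp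
  have "((\<lambda>s. s powr \<alpha> * m 0 (1 / s)) has_real_derivative \<alpha> * K + ?c) (at 1)"
  proof -
    have "((\<lambda>s. 1 / s) has_real_derivative - 1) (at (1::real))"
      by (auto intro!: derivative_eq_intros)
    then have "((\<lambda>s. m 0 (1 / s)) has_real_derivative - ?c * - 1) (at 1)"
      using d1 by (intro DERIV_chain2[where f = "\<lambda>s. m 0 s"]) simp_all
    moreover have "((\<lambda>s. s powr \<alpha>) has_real_derivative \<alpha>) (at 1)"
      by (auto intro!: derivative_eq_intros)
    ultimately show ?thesis
      using DERIV_mult[of "\<lambda>s. s powr \<alpha>" \<alpha> 1 UNIV "\<lambda>s. m 0 (1 / s)" "- ?c * - 1"]
      by (simp add: m_at_base ac_simps)
  qed
  moreover have "eventually (\<lambda>s. m 0 s = s powr \<alpha> * m 0 (1 / s)) (nhds 1)"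
    using eventually_nhds_in_open[of "{0<..}" "1::real"] m_swap[of _ 0]
    by (auto elim!: eventually_mono)
  ultimately have "((\<lambda>s. m 0 s) has_real_derivative \<alpha> * K + ?c) (at 1)"
    by (subst DERIV_cong_ev[OF refl _ refl])
  with d1 have "- ?c = \<alpha> * K + ?c" by (rule DERIV_unique)
  then show ?thesis by simp
qed

text \<open>
  The score lost by forecasting the law of \<open>u + s X\<close> when the truth is \<open>Q\<close>; see \<open>score_increment\<close>.
\<close>
definition divergence :: "real \<Rightarrow> real \<Rightarrow> real" where
  "divergence u s = \<alpha> / 2 * ln s + s powr (- \<alpha>) * m u s / K - 1"

text \<open>
  The gradient of \<open>divergence\<close> vanishes at \<open>(0, 1)\<close> by \<open>m1_0_at_base\<close> and \<open>m1_1_at_base\<close>, which also eliminate \<open>m1 0\<close> and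
  \<open>m1 1\<close> from the second derivatives at that point: in the direction of the scale the logarithm
  contributes \<open>- \<alpha> / 2\<close>, and the substitution of \<open>- (1 + \<alpha> / 2) K\<close> for \<open>m1 1 0 1\<close> leaves \<open>- (2 + \<alpha>)\<close>.
\<close>
lemma divergence_expansion:
  assumes "0 < \<epsilon>"
  obtains \<delta> where "0 < \<delta>" "\<delta> \<le> 1"
    "\<And>a b. \<bar>a\<bar> < \<delta> \<Longrightarrow> \<bar>b\<bar> < \<delta> \<Longrightarrow>
      \<bar>divergence a (1 + b) - (a\<^sup>2 * (m2 0 0 1 / K) + a * b * (2 * m2 1 0 1 / K)
         + b\<^sup>2 * (m2 2 0 1 / K - (2 + 3 * \<alpha> / 2))) / 2\<bar> \<le> \<epsilon> * (a\<^sup>2 + b\<^sup>2)"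
proof -
  define D1 where "D1 a b r = \<alpha> / 2 * b / (1 + r * b) - (1 + r * b) powr (- \<alpha> - 1)
      * (\<alpha> * b * m (r * a) (1 + r * b) + (b * m (r * a) (1 + r * b) + a * m1 0 (r * a) (1 + r * b) + b * m1 1 (r * a) (1 + r * b))) / K"
    for a b r
  define A where "A u s = s powr (- \<alpha> - 2) * m2 0 u s / K" for u s
  define B where "B u s = s powr (- \<alpha> - 2) * ((2 * \<alpha> + 4) * m1 0 u s + 2 * m2 1 u s) / K" for u s
  define C where "C u s = s powr (- \<alpha> - 2) * ((\<alpha>\<^sup>2 + 3 * \<alpha> + 2) * m u s + (2 * \<alpha> + 4) * m1 1 u s + m2 2 u s) / K
      - \<alpha> / (2 * s\<^sup>2)" for u s
  have pos: "0 < 1 + r * b" if "\<bar>b\<bar> < 1" "0 \<le> r" "r \<le> 1" for r b :: real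
  proof -
    have "\<bar>r * b\<bar> \<le> \<bar>b\<bar>" using that by (simp add: abs_mult mult_left_le_one_le)
    then show ?thesis using that by linarith
  qed
  have cont_at: "isCont (\<lambda>p. affine_mean \<phi> g (fst p) (snd p)) (0, 1)" if "weighted_integrable \<alpha> g" for g
    using continuous_affine_mean[OF that] by (simp add: continuous_on_eq_continuous_at)
  have cont: "isCont (\<lambda>p. m (fst p) (snd p)) (0, 1)"
    "isCont (\<lambda>p. m1 0 (fst p) (snd p)) (0, 1)" "isCont (\<lambda>p. m1 1 (fst p) (snd p)) (0, 1)"
    "isCont (\<lambda>p. m2 0 (fst p) (snd p)) (0, 1)" "isCont (\<lambda>p. m2 1 (fst p) (snd p)) (0, 1)"
    "isCont (\<lambda>p. m2 2 (fst p) (snd p)) (0, 1)"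
    unfolding m_def by - (rule cont_at, (rule weighted_f weighted_\<Psi>' weighted_q; simp))+
  show thesis
  proof (rule second_order_expansion_along_rays[of 1 divergence 0 1 D1 A B C \<epsilon>])
    fix a b r :: real
    assume ab: "\<bar>a\<bar> < 1" "\<bar>b\<bar> < 1" "0 \<le> r" "r \<le> 1"
    have s: "0 < 1 + r * b" using pos ab by blast
    let ?s = "1 + r * b"
    let ?N = "b * m (r * a) ?s + a * m1 0 (r * a) ?s + b * m1 1 (r * a) ?s"
    let ?N2 = "b\<^sup>2 * m (r * a) ?s + 3 * a * b * m1 0 (r * a) ?s + 3 * b\<^sup>2 * m1 1 (r * a) ?s
       + a\<^sup>2 * m2 0 (r * a) ?s + 2 * a * b * m2 1 (r * a) ?s + b\<^sup>2 * m2 2 (r * a) ?s"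
    \<comment> \<open>Expressing all powers of the scale by one of them leaves polynomial identities.\<close>
    have p: "?s powr (- \<alpha>) = ?s powr (- \<alpha> - 2) * ?s\<^sup>2" "?s powr (- \<alpha> - 1) = ?s powr (- \<alpha> - 2) * ?s"
      using s by (simp_all add: powr_diff powr_minus powr_numeral divide_simps power2_eq_square)
    have dp: "((\<lambda>t. (1 + t * b) powr c) has_real_derivative c * ?s powr (c - 1) * b) (at r)" for c
      using s by (auto intro!: derivative_eq_intros simp: powr_diff)
    note dm = m_ray_derivative[OF s, of a] and dN = m_ray_second_derivative[OF s, of a]
    have "((\<lambda>t. divergence (t * a) (1 + t * b)) has_real_derivative
       \<alpha> / 2 * (b / ?s) + (- \<alpha> * ?s powr (- \<alpha> - 1) * b * m (r * a) ?s + (- ?N / ?s) * ?s powr (- \<alpha>)) / K) (at r)"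
    proof -
      have "((\<lambda>t. ln (1 + t * b)) has_real_derivative b / ?s) (at r)"
        using s by (auto intro!: derivative_eq_intros)
      from DERIV_diff[OF DERIV_add[OF DERIV_cmult[OF this, of "\<alpha> / 2"]
          DERIV_cdivide[OF DERIV_mult[OF dp[of "- \<alpha>"] dm], of K]] DERIV_const[of 1]]
      show ?thesis unfolding divergence_def by simp
    qed
    moreover have "\<alpha> / 2 * (b / ?s) + (- \<alpha> * ?s powr (- \<alpha> - 1) * b * m (r * a) ?s + (- ?N / ?s) * ?s powr (- \<alpha>)) / K = D1 a b r"
      unfolding D1_def p using s by (simp add: divide_simps power2_eq_square) (simp add: algebra_simps)
    ultimately show "((\<lambda>t. divergence (0 + t * a) (1 + t * b)) has_real_derivative D1 a b r) (at r)" by simp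
    have "(D1 a b has_real_derivative
        - (\<alpha> / 2 * b * b / ?s\<^sup>2) - ((- \<alpha> - 1) * ?s powr (- \<alpha> - 1 - 1) * b * (\<alpha> * b * m (r * a) ?s + ?N)
           + (\<alpha> * b * (- ?N / ?s) + (- ?N2 / ?s)) * ?s powr (- \<alpha> - 1)) / K) (at r)"
    proof -
      have "((\<lambda>t. \<alpha> / 2 * b / (1 + t * b)) has_real_derivative - (\<alpha> / 2 * b * b / ?s\<^sup>2)) (at r)"
      proof (rule DERIV_cong)
        show "((\<lambda>t. \<alpha> / 2 * b / (1 + t * b)) has_real_derivative (0 * ?s - \<alpha> / 2 * b * b) / (?s * ?s)) (at r)"
          using s by (intro DERIV_divide) (auto intro!: derivative_eq_intros)
      qed (simp only: power2_eq_square mult_zero_left diff_0 minus_divide_left)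
      from DERIV_diff[OF this DERIV_cdivide[OF DERIV_mult[OF dp[of "- \<alpha> - 1"]
          DERIV_add[OF DERIV_cmult[OF dm, of "\<alpha> * b"] dN]], of K]]
      show ?thesis unfolding D1_def[abs_def] .
    qed
    moreover have "- (\<alpha> / 2 * b * b / ?s\<^sup>2) - ((- \<alpha> - 1) * ?s powr (- \<alpha> - 1 - 1) * b * (\<alpha> * b * m (r * a) ?s + ?N)
           + (\<alpha> * b * (- ?N / ?s) + (- ?N2 / ?s)) * ?s powr (- \<alpha> - 1)) / K
       = a\<^sup>2 * A (0 + r * a) ?s + a * b * B (0 + r * a) ?s + b\<^sup>2 * C (0 + r * a) ?s"
    proof -
      have "(x * (- y / z) + (- w / z)) * (P * z) = - (x * y + w) * P" if "0 < z" for x y z w P :: real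
        using that by (simp add: field_simps)
      then have e: "(\<alpha> * b * (- ?N / ?s) + (- ?N2 / ?s)) * ?s powr (- \<alpha> - 1) = - (\<alpha> * b * ?N + ?N2) * ?s powr (- \<alpha> - 2)"
        unfolding p using s by blast
      have e': "- \<alpha> - 1 - 1 = - \<alpha> - 2" by simp
      have alg: "(- \<alpha> - 1) * P * b * (\<alpha> * b * M + (b * M + a * M1 + b * M1'))
           + - (\<alpha> * b * (b * M + a * M1 + b * M1')
              + (b\<^sup>2 * M + 3 * a * b * M1 + 3 * b\<^sup>2 * M1' + a\<^sup>2 * M2 + 2 * a * b * M2' + b\<^sup>2 * M2'')) * P
         = - (a\<^sup>2 * (P * M2) + a * b * (P * ((2 * \<alpha> + 4) * M1 + 2 * M2'))
           + b\<^sup>2 * (P * ((\<alpha>\<^sup>2 + 3 * \<alpha> + 2) * M + (2 * \<alpha> + 4) * M1' + M2'')))"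
        for P M M1 M1' M2 M2' M2'' :: real
        by algebra
      have "- (\<alpha> / 2 * b * b / S) - (- (a\<^sup>2 * X + a * b * Y + b\<^sup>2 * Z)) / k
         = a\<^sup>2 * (X / k) + a * b * (Y / k) + b\<^sup>2 * (Z / k - \<alpha> / (2 * S))" for S X Y Z k :: real
        by (simp add: add_divide_distrib diff_divide_distrib right_diff_distrib power2_eq_square mult_ac)
      then show ?thesis unfolding e e' alg A_def B_def C_def add_0_left .
    qed
    ultimately show "(D1 a b has_real_derivative
        a\<^sup>2 * A (0 + r * a) ?s + a * b * B (0 + r * a) ?s + b\<^sup>2 * C (0 + r * a) ?s) (at r)" by simp
  next
    fix a b
    have "\<alpha> * b * K + (b * K + a * m1 0 0 1 + b * m1 1 0 1) = \<alpha> * b * K + b * (K + m1 1 0 1)"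
      unfolding m1_0_at_base by (simp only: distrib_left mult_zero_right add_0_right)
    also have "\<dots> = b * (\<alpha> / 2 * K)"
      unfolding m1_1_at_base by simp
    finally have e: "\<alpha> * b * K + (b * K + a * m1 0 0 1 + b * m1 1 0 1) = b * (\<alpha> / 2 * K)" .
    have "D1 a b 0 = \<alpha> / 2 * b - (\<alpha> * b * K + (b * K + a * m1 0 0 1 + b * m1 1 0 1)) / K"
      by (simp add: D1_def m_at_base)
    then show "D1 a b 0 = 0" unfolding e using K_pos by simp
  next
    have cont_s: "isCont (\<lambda>p. snd p powr (- \<alpha> - 2)) (0 :: real, 1)" "isCont (\<lambda>p. \<alpha> / (2 * (snd p)\<^sup>2)) (0 :: real, 1)"
      by (auto intro!: continuous_intros)
    show "isCont (\<lambda>p. A (fst p) (snd p)) (0, 1)" "isCont (\<lambda>p. B (fst p) (snd p)) (0, 1)"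
      "isCont (\<lambda>p. C (fst p) (snd p)) (0, 1)"
      unfolding A_def B_def C_def
      using K_pos by - (intro isCont_diff isCont_divide isCont_mult isCont_add continuous_const cont cont_s; simp)+
  next
    fix \<delta> :: real
    have A: "A 0 1 = m2 0 0 1 / K" by (simp add: A_def)
    have B: "B 0 1 = 2 * m2 1 0 1 / K" unfolding B_def m1_0_at_base by simp
    have C: "C 0 1 = m2 2 0 1 / K - (2 + 3 * \<alpha> / 2)"
    proof -
      have *: "m1 1 0 1 = - (\<alpha> / 2) * K - K" using m1_1_at_base by (metis add_diff_cancel_left')
      have "(\<alpha>\<^sup>2 + 3 * \<alpha> + 2) * k + (2 * \<alpha> + 4) * (- (\<alpha> / 2) * k - k) + X = (- \<alpha> - 2) * k + X" for k X :: real
        by (simp add: algebra_simps power2_eq_square)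
      then show ?thesis
        unfolding C_def m_at_base * using K_pos by (simp add: add_divide_distrib)
    qed
    have D0: "divergence 0 1 = 0" using K_pos by (simp add: divergence_def m_at_base)
    assume "0 < \<delta>" "\<delta> \<le> 1"
      "\<And>a b. \<bar>a\<bar> < \<delta> \<Longrightarrow> \<bar>b\<bar> < \<delta> \<Longrightarrow>
        \<bar>divergence (0 + a) (1 + b) - divergence 0 1 - (a\<^sup>2 * A 0 1 + a * b * B 0 1 + b\<^sup>2 * C 0 1) / 2\<bar> \<le> \<epsilon> * (a\<^sup>2 + b\<^sup>2)"
    then show thesis by (intro that[of \<delta>]) (simp_all add: A B C D0)
  qed (use assms in simp_all)
qed

section \<open>Expected scores in a location-scale family\<close>

text \<open>
  A shift cancels in \<open>X - Y\<close>, and the kernel is homogeneous of degree \<open>\<alpha>\<close>.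
\<close>
lemma kernel_moment_loc_scale:
  assumes "0 < \<theta> $ 2"
  shows "kernel_moment \<alpha> (loc_scale Q \<theta>) = (\<theta> $ 2) powr \<alpha> * K"
proof -
  let ?T = "\<lambda>z. \<theta> $ 1 + \<theta> $ 2 * z"
  have [measurable]: "?T \<in> Q \<rightarrow>\<^sub>M borel" by measurable
  interpret T: prob_space "distr Q borel ?T" by (rule prob_space_distr) measurable
  have "loc_scale Q \<theta> \<Otimes>\<^sub>M loc_scale Q \<theta> = distr (Q \<Otimes>\<^sub>M Q) (borel \<Otimes>\<^sub>M borel) (\<lambda>(x, y). (?T x, ?T y))"
    unfolding loc_scale_def by (rule pair_measure_distr) (auto intro: T.sigma_finite_measure_axioms)
  then have "kernel_moment \<alpha> (loc_scale Q \<theta>) = (\<integral>(x, y). \<bar>?T x - ?T y\<bar> powr \<alpha> \<partial>(Q \<Otimes>\<^sub>M Q))"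
    unfolding kernel_moment_def by (simp add: integral_distr case_prod_unfold)
  also have "\<dots> = (\<integral>(x, y). (\<theta> $ 2) powr \<alpha> * \<bar>x - y\<bar> powr \<alpha> \<partial>(Q \<Otimes>\<^sub>M Q))"
  proof -
    have "\<bar>?T x - ?T y\<bar> = \<theta> $ 2 * \<bar>x - y\<bar>" for x y
      using assms by (simp add: abs_mult flip: right_diff_distrib)
    then show ?thesis using assms by (simp add: powr_mult)
  qed
  also have "\<dots> = (\<theta> $ 2) powr \<alpha> * K"
    unfolding kernel_moment_def by (simp add: case_prod_unfold)
  finally show ?thesis .
qed

text \<open>
  The affine map that takes the law of the outcome, \<open>loc_scale Q \<theta>\<close>, back to \<open>Q\<close> takes the forecast to
  the law of \<open>u + s X\<close> with the relative shift \<open>u\<close> and scale \<open>s\<close>; a factor \<open>(\<theta> $ 2) powr \<alpha>\<close> cancels against the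
  normalization.
\<close>
lemma expected_score_loc_scale:
  assumes \<theta>: "0 < \<theta> $ 2" and \<theta>': "0 < \<theta>' $ 2"
  shows "expected_score (S_sta \<alpha>) (loc_scale Q \<theta>') (loc_scale Q \<theta>)
    = - (1 / 2) * ln ((\<theta>' $ 2) powr \<alpha> * K)
      - (\<theta>' $ 2 / \<theta> $ 2) powr (- \<alpha>) * m ((\<theta>' $ 1 - \<theta> $ 1) / \<theta> $ 2) (\<theta>' $ 2 / \<theta> $ 2) / K + 1"
proof -
  define u s where "u = (\<theta>' $ 1 - \<theta> $ 1) / \<theta> $ 2" and "s = \<theta>' $ 2 / \<theta> $ 2"
  define P where "P = loc_scale Q \<theta>'"
  define k where "k = kernel_moment \<alpha> P"
  have k: "k = (\<theta>' $ 2) powr \<alpha> * K" unfolding k_def P_def by (rule kernel_moment_loc_scale[OF \<theta>'])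
  interpret P: prob_space P unfolding P_def loc_scale_def by (rule prob_space_distr) measurable
  have [measurable_cong]: "sets P = sets borel" by (simp add: P_def loc_scale_def)
  have "expected_score (S_sta \<alpha>) P (loc_scale Q \<theta>)
      = (\<integral>y. - (1 / 2) * ln k - (\<integral>x. \<bar>x - (\<theta> $ 1 + \<theta> $ 2 * y)\<bar> powr \<alpha> \<partial>P) / k + 1 \<partial>Q)"
    unfolding expected_score_def loc_scale_def S_sta_def k_def[symmetric]
    by (rule integral_distr) measurable
  also have "(\<lambda>y. \<integral>x. \<bar>x - (\<theta> $ 1 + \<theta> $ 2 * y)\<bar> powr \<alpha> \<partial>P)
      = (\<lambda>y. (\<theta> $ 2) powr \<alpha> * (\<integral>x. \<bar>u + s * x - y\<bar> powr \<alpha> \<partial>Q))"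
  proof
    fix y
    have "\<bar>\<theta>' $ 1 + \<theta>' $ 2 * x - (\<theta> $ 1 + \<theta> $ 2 * y)\<bar> = \<theta> $ 2 * \<bar>u + s * x - y\<bar>" for x
    proof -
      have "\<theta>' $ 1 + \<theta>' $ 2 * x - (\<theta> $ 1 + \<theta> $ 2 * y) = \<theta> $ 2 * (u + s * x - y)"
        using \<theta> by (simp add: u_def s_def field_simps)
      then show ?thesis using \<theta> by (simp add: abs_mult)
    qed
    then show "(\<integral>x. \<bar>x - (\<theta> $ 1 + \<theta> $ 2 * y)\<bar> powr \<alpha> \<partial>P) = (\<theta> $ 2) powr \<alpha> * (\<integral>x. \<bar>u + s * x - y\<bar> powr \<alpha> \<partial>Q)"
      unfolding P_def loc_scale_def using \<theta> by (subst integral_distr) (auto simp: powr_mult)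
  qed
  also have "(\<integral>y. - (1 / 2) * ln k - (\<theta> $ 2) powr \<alpha> * (\<integral>x. \<bar>u + s * x - y\<bar> powr \<alpha> \<partial>Q) / k + 1 \<partial>Q)
     = - (1 / 2) * ln k - (\<theta> $ 2) powr \<alpha> * m u s / k + 1"
  proof -
    let ?k = "\<lambda>(y, x). \<bar>u + s * x - y\<bar> powr \<alpha>"
    have int: "integrable (Q \<Otimes>\<^sub>M Q) ?k"
      using QQ.integrable_product_swap[OF m_integrable[of u s]] by (simp add: case_prod_unfold)
    have "integrable Q (\<lambda>y. \<integral>x. \<bar>u + s * x - y\<bar> powr \<alpha> \<partial>Q)"
      using QQ.integrable_fst'[OF int] by simp
    moreover have "(\<integral>y. \<integral>x. \<bar>u + s * x - y\<bar> powr \<alpha> \<partial>Q \<partial>Q) = m u s"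
    proof -
      have "(\<integral>y. \<integral>x. \<bar>u + s * x - y\<bar> powr \<alpha> \<partial>Q \<partial>Q) = integral\<^sup>L (Q \<Otimes>\<^sub>M Q) ?k"
        using QQ.integral_fst'[OF int] by simp
      also have "\<dots> = m u s"
        unfolding m_eq
        using QQ.integral_product_swap[of "\<lambda>(x, y). \<bar>u + s * x - y\<bar> powr \<alpha>"] m_integrable[of u s]
        by (simp add: case_prod_unfold borel_measurable_integrable)
      finally show ?thesis .
    qed
    ultimately show ?thesis by (simp add: prob_space[unfolded space_Q])
  qed
  also have "(\<theta> $ 2) powr \<alpha> * m u s / k = s powr (- \<alpha>) * m u s / K"
    using \<theta> \<theta>' K_pos by (simp add: k s_def powr_minus powr_divide field_simps)
  finally show ?thesis unfolding P_def k u_def s_def .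
qed

lemma score_increment:
  assumes \<theta>: "0 < \<theta> $ 2" and d: "0 < (\<theta> + d) $ 2"
  shows "expected_score (S_sta \<alpha>) (loc_scale Q \<theta>) (loc_scale Q \<theta>)
      - expected_score (S_sta \<alpha>) (loc_scale Q (\<theta> + d)) (loc_scale Q \<theta>)
    = divergence (d $ 1 / \<theta> $ 2) (1 + d $ 2 / \<theta> $ 2)"
proof -
  have s: "(\<theta> + d) $ 2 / \<theta> $ 2 = 1 + d $ 2 / \<theta> $ 2" using \<theta> by (simp add: field_simps)
  have u: "((\<theta> + d) $ 1 - \<theta> $ 1) / \<theta> $ 2 = d $ 1 / \<theta> $ 2" by simp
  have ln_ratio: "ln (1 + d $ 2 / \<theta> $ 2) = ln ((\<theta> + d) $ 2) - ln (\<theta> $ 2)"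
    unfolding s[symmetric] using \<theta> d by (simp add: ln_div del: vector_add_component)
  have ln_moment: "ln (t powr \<alpha> * K) = \<alpha> * ln t + ln K" if "0 < t" for t
    using that K_pos by (simp add: ln_mult ln_powr)
  show ?thesis
    unfolding expected_score_loc_scale[OF \<theta> d] expected_score_loc_scale[OF \<theta> \<theta>] s u divergence_def
      ln_ratio ln_moment[OF \<theta>] ln_moment[OF d]
    using \<theta> K_pos by (simp add: m_at_base distrib_left right_diff_distrib add_divide_distrib
      diff_divide_distrib del: vector_add_component)
qed

end

section \<open>The scale function\<close>

definition sym_matrix :: "real \<Rightarrow> real \<Rightarrow> real \<Rightarrow> real^2^2" where
  "sym_matrix a b c = vector [vector [a, b], vector [b, c]]"

lemma sym_matrix_linear:
  "sym_matrix a b c = a *\<^sub>R sym_matrix 1 0 0 + b *\<^sub>R sym_matrix 0 1 0 + c *\<^sub>R sym_matrix 0 0 1"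
  by (simp add: sym_matrix_def vec_eq_iff forall_2)

lemma transpose_sym_matrix: "transpose (sym_matrix a b c) = sym_matrix a b c"
  by (simp add: sym_matrix_def transpose_def vec_eq_iff forall_2)

lemma scaleR_sym_matrix: "k *\<^sub>R sym_matrix a b c = sym_matrix (k * a) (k * b) (k * c)"
  by (simp add: sym_matrix_def vec_eq_iff forall_2)

lemma quadratic_form_sym_matrix:
  "d \<bullet> (sym_matrix a b c *v d) = a * (d $ 1)\<^sup>2 + 2 * b * (d $ 1 * d $ 2) + c * (d $ 2)\<^sup>2"
  by (simp add: sym_matrix_def inner_vec_def sum_2 matrix_vector_mult_def power2_eq_square algebra_simps)

lemma has_bochner_integral_sym_matrix:
  assumes "has_bochner_integral M f a" "has_bochner_integral M g b" "has_bochner_integral M h c"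
  shows "has_bochner_integral M (\<lambda>z. sym_matrix (f z) (g z) (h z)) (sym_matrix a b c)"
  unfolding sym_matrix_linear[of "f _"] sym_matrix_linear[of a]
  by (intro has_bochner_integral_add has_bochner_integral_scaleR_left assms)

text \<open>
  The correction \<open>1 + 3 * \<alpha> / 4\<close> is half the constant that appears in \<open>divergence_expansion\<close>. The
  function \<open>q\<close> is to be the quotient \<open>f'' / f\<close> for the density \<open>f\<close> of \<open>Q\<close>.
\<close>
definition scale_kernel :: "real \<Rightarrow> real measure \<Rightarrow> (real \<Rightarrow> real) \<Rightarrow> real \<times> real \<Rightarrow> real^2^2" where
  "scale_kernel \<alpha> Q q = (\<lambda>(x, y).
     let w = \<bar>x - y\<bar> powr \<alpha> * q x / (2 * kernel_moment \<alpha> Q)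
     in vector [vector [w, w * x], vector [w * x, w * x\<^sup>2 - (1 + 3 * \<alpha> / 4)]])"

context smooth_density
begin

lemma scale_kernel_integral:
  "has_bochner_integral (Q \<Otimes>\<^sub>M Q) (scale_kernel \<alpha> Q q)
    (sym_matrix (m2 0 0 1 / (2 * K)) (m2 1 0 1 / (2 * K)) (m2 2 0 1 / (2 * K) - (1 + 3 * \<alpha> / 4)))"
proof -
  have moment: "has_bochner_integral (Q \<Otimes>\<^sub>M Q) (\<lambda>z. \<bar>fst z - snd z\<bar> powr \<alpha> * (fst z ^ j * q (fst z)) / (2 * K)) (m2 j 0 1 / (2 * K))"
    if "j \<le> 2" for j
  proof -
    have "has_bochner_integral (Q \<Otimes>\<^sub>M Q) (\<lambda>z. \<bar>fst z - snd z\<bar> powr \<alpha> * (fst z ^ j * q (fst z))) (m2 j 0 1)"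
      using pair_kernel_integrable[OF weighted_q[OF that], of 0 1]
      by (simp add: has_bochner_integral_iff case_prod_unfold)
    then show ?thesis by (rule has_bochner_integral_divide_zero)
  qed
  have const: "has_bochner_integral (Q \<Otimes>\<^sub>M Q) (\<lambda>_. 1 + 3 * \<alpha> / 4) (1 + 3 * \<alpha> / 4)"
    by (simp add: has_bochner_integral_iff QQ.prob_space)
  have "scale_kernel \<alpha> Q q = (\<lambda>z. sym_matrix
      (\<bar>fst z - snd z\<bar> powr \<alpha> * (fst z ^ 0 * q (fst z)) / (2 * K))
      (\<bar>fst z - snd z\<bar> powr \<alpha> * (fst z ^ 1 * q (fst z)) / (2 * K))
      (\<bar>fst z - snd z\<bar> powr \<alpha> * (fst z ^ 2 * q (fst z)) / (2 * K) - (1 + 3 * \<alpha> / 4)))"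
    by (auto simp: scale_kernel_def sym_matrix_def fun_eq_iff Let_def vec_eq_iff forall_2)
  then show ?thesis
    by (simp only:) (intro has_bochner_integral_sym_matrix has_bochner_integral_diff const moment; simp)
qed

text \<open>
  In the rescaled variables \<open>a = d $ 1 / \<sigma>\<close>, \<open>b = d $ 2 / \<sigma>\<close> this is \<open>divergence_expansion\<close>; the error
  bound there is used with the constant \<open>c * \<sigma>\<^sup>2\<close> to compensate for \<open>a\<^sup>2 + b\<^sup>2 = (norm d)\<^sup>2 / \<sigma>\<^sup>2\<close>.
\<close>
lemma score_increment_smallo:
  assumes \<theta>: "0 < \<theta> $ 2"
  defines "M \<equiv> (1 / (\<theta> $ 2)\<^sup>2) *\<^sub>R (\<integral>z. scale_kernel \<alpha> Q q z \<partial>(Q \<Otimes>\<^sub>M Q))"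
  shows "transpose M = M"
    and "(\<lambda>d. expected_score (S_sta \<alpha>) (loc_scale Q \<theta>) (loc_scale Q \<theta>)
              - expected_score (S_sta \<alpha>) (loc_scale Q (\<theta> + d)) (loc_scale Q \<theta>)
              - d \<bullet> (M *v d)) \<in> o[at 0](\<lambda>d. norm d ^ 2)"
proof -
  let ?\<sigma> = "\<theta> $ 2"
  have M: "M = sym_matrix (1 / ?\<sigma>\<^sup>2 * (m2 0 0 1 / (2 * K))) (1 / ?\<sigma>\<^sup>2 * (m2 1 0 1 / (2 * K)))
      (1 / ?\<sigma>\<^sup>2 * (m2 2 0 1 / (2 * K) - (1 + 3 * \<alpha> / 4)))"
    unfolding M_def has_bochner_integral_integral_eq[OF scale_kernel_integral] scaleR_sym_matrix ..
  show "transpose M = M" unfolding M by (rule transpose_sym_matrix)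
  show "(\<lambda>d. expected_score (S_sta \<alpha>) (loc_scale Q \<theta>) (loc_scale Q \<theta>)
              - expected_score (S_sta \<alpha>) (loc_scale Q (\<theta> + d)) (loc_scale Q \<theta>)
              - d \<bullet> (M *v d)) \<in> o[at 0](\<lambda>d. norm d ^ 2)"
  proof (rule landau_o.smallI)
    fix c :: real assume "0 < c"
    then have "0 < c * ?\<sigma>\<^sup>2" using \<theta> by simp
    then obtain \<delta> where \<delta>: "0 < \<delta>" "\<delta> \<le> 1" and exp: "\<And>a b. \<bar>a\<bar> < \<delta> \<Longrightarrow> \<bar>b\<bar> < \<delta> \<Longrightarrow>
      \<bar>divergence a (1 + b) - (a\<^sup>2 * (m2 0 0 1 / K) + a * b * (2 * m2 1 0 1 / K)
         + b\<^sup>2 * (m2 2 0 1 / K - (2 + 3 * \<alpha> / 2))) / 2\<bar> \<le> c * ?\<sigma>\<^sup>2 * (a\<^sup>2 + b\<^sup>2)"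
      using divergence_expansion by blast
    have "norm (expected_score (S_sta \<alpha>) (loc_scale Q \<theta>) (loc_scale Q \<theta>)
              - expected_score (S_sta \<alpha>) (loc_scale Q (\<theta> + d)) (loc_scale Q \<theta>)
              - d \<bullet> (M *v d)) \<le> c * norm (norm d ^ 2)" if d: "norm d < \<delta> * ?\<sigma>" for d
    proof -
      define a b where "a = d $ 1 / ?\<sigma>" and "b = d $ 2 / ?\<sigma>"
      have small: "\<bar>d $ i\<bar> < \<delta> * ?\<sigma>" for i
        using component_le_norm_cart[of d i] d by linarith
      have ab: "\<bar>a\<bar> < \<delta>" "\<bar>b\<bar> < \<delta>"
        using small[of 1] small[of 2] \<theta> by (simp_all add: a_def b_def field_simps)
      have "\<delta> * ?\<sigma> \<le> ?\<sigma>" using \<delta> \<theta> by (simp add: mult_left_le_one_le)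
      then have pos: "0 < (\<theta> + d) $ 2" using small[of 2] by simp
      have quad: "d \<bullet> (M *v d) = (a\<^sup>2 * (m2 0 0 1 / K) + a * b * (2 * m2 1 0 1 / K)
         + b\<^sup>2 * (m2 2 0 1 / K - (2 + 3 * \<alpha> / 2))) / 2"
        unfolding M quadratic_form_sym_matrix a_def b_def using \<theta> K_pos
        by (simp add: field_simps power2_eq_square)
      have nd: "?\<sigma>\<^sup>2 * (a\<^sup>2 + b\<^sup>2) = (norm d)\<^sup>2"
      proof -
        have "(norm d)\<^sup>2 = (d $ 1)\<^sup>2 + (d $ 2)\<^sup>2"
          unfolding power2_norm_eq_inner by (simp add: inner_vec_def sum_2 power2_eq_square)
        then show ?thesis using \<theta> by (simp add: a_def b_def power_divide distrib_left)
      qed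
      show ?thesis
        using exp[OF ab, unfolded mult.assoc[of c] nd]
        unfolding score_increment[OF \<theta> pos] quad a_def[symmetric] b_def[symmetric]
        by (simp only: real_norm_def abs_of_nonneg[OF zero_le_power2])
    qed
    then show "\<forall>\<^sub>F d in at 0. norm (expected_score (S_sta \<alpha>) (loc_scale Q \<theta>) (loc_scale Q \<theta>)
              - expected_score (S_sta \<alpha>) (loc_scale Q (\<theta> + d)) (loc_scale Q \<theta>)
              - d \<bullet> (M *v d)) \<le> c * norm (norm d ^ 2)"
      unfolding eventually_at using \<delta> \<theta> by (intro exI[of _ "\<delta> * ?\<sigma>"]) auto
  qed
qed

end

lemma assumption_A_imp_smooth_density:
  assumes "assumption_A \<alpha> Q" "0 < \<alpha>"
  shows "\<exists>\<Psi> \<Psi>' \<Psi>''. smooth_density Q \<alpha> \<Psi> \<Psi>' \<Psi>''"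
  using assms unfolding assumption_A_def smooth_density_def smooth_density_axioms_def by blast

text \<open>
  The regularity assumption only asserts that a smooth log-density exists, whereas the matrix must be
  a function of \<open>\<alpha>\<close> and \<open>Q\<close>; hence \<open>f'' / f\<close> is selected from some admissible log-density.
\<close>
definition relative_curvature :: "real \<Rightarrow> real measure \<Rightarrow> real \<Rightarrow> real" where
  "relative_curvature \<alpha> Q = (SOME q. \<exists>\<Psi> \<Psi>' \<Psi>''. smooth_density Q \<alpha> \<Psi> \<Psi>' \<Psi>'' \<and> q = smooth_density.q \<Psi>' \<Psi>'')"

lemma relative_curvature:
  assumes "assumption_A \<alpha> Q" "0 < \<alpha>"
  obtains \<Psi> \<Psi>' \<Psi>'' where "smooth_density Q \<alpha> \<Psi> \<Psi>' \<Psi>''" "relative_curvature \<alpha> Q = smooth_density.q \<Psi>' \<Psi>''"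
proof -
  have "\<exists>q \<Psi> \<Psi>' \<Psi>''. smooth_density Q \<alpha> \<Psi> \<Psi>' \<Psi>'' \<and> q = smooth_density.q \<Psi>' \<Psi>''"
    using assumption_A_imp_smooth_density[OF assms] by blast
  from someI_ex[OF this] show ?thesis
    using that unfolding relative_curvature_def by blast
qed

theorem proposition4:
  "\<exists>H :: real \<Rightarrow> real measure \<Rightarrow> real \<times> real \<Rightarrow> real^2^2.
     \<forall>\<alpha>\<in>{0<..2}. \<forall>Q0 :: real measure set.
       (\<forall>Q\<in>Q0. assumption_A \<alpha> Q) \<longrightarrow>
       finite_scores_on (loc_scale_class Q0) (S_sta \<alpha>) \<longrightarrow>
       (\<forall>Q\<in>Q0. integrable (Q \<Otimes>\<^sub>M Q) (H \<alpha> Q)) \<and>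
       has_scale_function (S_sta \<alpha>) Q0
         (\<lambda>Q \<theta>. (1 / (\<theta> $ 2)\<^sup>2) *\<^sub>R (\<integral>z. H \<alpha> Q z \<partial>(Q \<Otimes>\<^sub>M Q)))"
proof (intro exI[of _ "\<lambda>\<alpha> Q. scale_kernel \<alpha> Q (relative_curvature \<alpha> Q)"] ballI allI impI)
  fix \<alpha> :: real and Q0 :: "real measure set"
  assume "\<alpha> \<in> {0<..2}" and A: "\<forall>Q\<in>Q0. assumption_A \<alpha> Q"
  then have \<alpha>: "0 < \<alpha>" by simp
  have "integrable (Q \<Otimes>\<^sub>M Q) (scale_kernel \<alpha> Q (relative_curvature \<alpha> Q))" if Q: "Q \<in> Q0" for Q
  proof -
    obtain \<Psi> \<Psi>' \<Psi>'' where d: "smooth_density Q \<alpha> \<Psi> \<Psi>' \<Psi>''"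
      and q: "relative_curvature \<alpha> Q = smooth_density.q \<Psi>' \<Psi>''"
      by (rule relative_curvature[OF bspec[OF A Q] \<alpha>])
    show ?thesis
      unfolding q using smooth_density.scale_kernel_integral[OF d] by (rule integrable.intros)
  qed
  moreover have "has_scale_function (S_sta \<alpha>) Q0
      (\<lambda>Q \<theta>. (1 / (\<theta> $ 2)\<^sup>2) *\<^sub>R (\<integral>z. scale_kernel \<alpha> Q (relative_curvature \<alpha> Q) z \<partial>(Q \<Otimes>\<^sub>M Q)))"
    unfolding has_scale_function_def loc_scale_params_def
  proof (intro ballI)
    fix Q and \<theta> :: "real^2" assume "Q \<in> Q0" and \<theta>: "\<theta> \<in> {\<theta>. 0 < \<theta> $ 2}"
    obtain \<Psi> \<Psi>' \<Psi>'' where d: "smooth_density Q \<alpha> \<Psi> \<Psi>' \<Psi>''"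
      and q: "relative_curvature \<alpha> Q = smooth_density.q \<Psi>' \<Psi>''"
      by (rule relative_curvature[OF bspec[OF A \<open>Q \<in> Q0\<close>] \<alpha>])
    from \<theta> have \<theta>: "0 < \<theta> $ 2" by simp
    show "transpose ((1 / (\<theta> $ 2)\<^sup>2) *\<^sub>R (\<integral>z. scale_kernel \<alpha> Q (relative_curvature \<alpha> Q) z \<partial>(Q \<Otimes>\<^sub>M Q)))
        = (1 / (\<theta> $ 2)\<^sup>2) *\<^sub>R (\<integral>z. scale_kernel \<alpha> Q (relative_curvature \<alpha> Q) z \<partial>(Q \<Otimes>\<^sub>M Q)) \<and>
      (\<lambda>d. expected_score (S_sta \<alpha>) (loc_scale Q \<theta>) (loc_scale Q \<theta>)
          - expected_score (S_sta \<alpha>) (loc_scale Q (\<theta> + d)) (loc_scale Q \<theta>)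
          - d \<bullet> ((1 / (\<theta> $ 2)\<^sup>2) *\<^sub>R (\<integral>z. scale_kernel \<alpha> Q (relative_curvature \<alpha> Q) z \<partial>(Q \<Otimes>\<^sub>M Q)) *v d))
        \<in> o[at 0](\<lambda>d. norm d ^ 2)"
      unfolding q using smooth_density.score_increment_smallo[OF d \<theta>] by blast
  qed
  ultimately show "(\<forall>Q\<in>Q0. integrable (Q \<Otimes>\<^sub>M Q) (scale_kernel \<alpha> Q (relative_curvature \<alpha> Q))) \<and>
      has_scale_function (S_sta \<alpha>) Q0
        (\<lambda>Q \<theta>. (1 / (\<theta> $ 2)\<^sup>2) *\<^sub>R (\<integral>z. scale_kernel \<alpha> Q (relative_curvature \<alpha> Q) z \<partial>(Q \<Otimes>\<^sub>M Q)))"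
    by blast
qed

end
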